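(* For infinitely many odd prime powers $q$, the CAP bound for $\Gamma_{q^-}$ is strictly smaller than the Delsarte bound for $\Gamma_{q^-}$.
   Context: Let $q$ be an odd prime power, $\mathcal{O}$ a non-degenerate conic in the Desarguesian projective plane $\mathrm{PG}(2,q)$, and $\perp$ the polarity induced by $\mathcal{O}$. A line is external if it meets $\mathcal{O}$ in no point. The graph $\Gamma_{q^-}$ has as vertices the external lines of $\mathcal{O}$, with two distinct external lines $a,b$ adjacent if and only if they are polar conjugates with respect to $\perp$, i.e. the pole $a^\perp$ lies on $b$ (equivalently $b^\perp$ lies on $a$). It is an orbital graph (a single relation of the Schurian association scheme) of the action of $\mathrm{PGL}(2,q)\le\mathrm{PGL}(3,q)$, the stabiliser of $\mathcal{O}$, on external lines; it is edge-regular, with $v=q(q-1)/2$ vertices and valency $k=(q+1)/2$. A graph is $(v,k,\lambda)$ edge-regular if it has $v$ vertices, every vertex has degree $k$, and every two adjacent vertices have exactly $\lambda$ common neighbours. For such a graph $\Gamma$ the clique adjacency polynomial is $$\mathrm{CA}_\Gamma(x,s):=x(x+1)(v-s)-2xs(k-s+1)+s(s-1)(\lambda-s+2).$$ If $\mathrm{CA}_\Gamma(x,s)<0$ for some integer $x$, then $\Gamma$ has no $s$-clique; the CAP bound for $\Gamma$ is the least value of $s-1$ over all integers $s\ge2$ for which there is an integer $x$ with $\mathrm{CA}_\Gamma(x,s)<0$. The Delsarte bound for a graph $\Gamma$ that is a single relation of an association scheme is the real number $1-k/\gamma_v$, where $k$ is the valency and $\gamma_v$ the minimum eigenvalue of the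 adjacency matrix of $\Gamma$. *)

theory Defs
  imports
    "HOL-Algebra.Ring"
    "HOL-Number_Theory.Prime_Powers"
    "Jordan_Normal_Form.Spectral_Radius"
begin

section \<open>The projective plane over a field\<close>

text \<open>
  Points and lines of the Desarguesian plane over a field \<open>F\<close> are the one- and
  two-dimensional subspaces of the space of triples over \<open>F\<close>; incidence is inclusion.
\<close>

type_synonym 'a triple = "'a \<times> 'a \<times> 'a"

definition triples :: "'a ring \<Rightarrow> 'a triple set" where
  "triples F = carrier F \<times> carrier F \<times> carrier F"

definition tzero :: "'a ring \<Rightarrow> 'a triple" where
  "tzero F = (\<zero>\<^bsub>F\<^esub>, \<zero>\<^bsub>F\<^esub>, \<zero>\<^bsub>F\<^esub>)"

fun tadd :: "'a ring \<Rightarrow> 'a triple \<Rightarrow> 'a triple \<Rightarrow> 'a triple" where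
  "tadd F (x, y, z) (x', y', z') = (x \<oplus>\<^bsub>F\<^esub> x', y \<oplus>\<^bsub>F\<^esub> y', z \<oplus>\<^bsub>F\<^esub> z')"

fun tscale :: "'a ring \<Rightarrow> 'a \<Rightarrow> 'a triple \<Rightarrow> 'a triple" where
  "tscale F c (x, y, z) = (c \<otimes>\<^bsub>F\<^esub> x, c \<otimes>\<^bsub>F\<^esub> y, c \<otimes>\<^bsub>F\<^esub> z)"

definition independent_pair :: "'a ring \<Rightarrow> 'a triple \<Rightarrow> 'a triple \<Rightarrow> bool" where
  "independent_pair F u w \<longleftrightarrow>
     (\<forall>a\<in>carrier F. \<forall>b\<in>carrier F.
        tadd F (tscale F a u) (tscale F b w) = tzero F \<longrightarrow> a = \<zero>\<^bsub>F\<^esub> \<and> b = \<zero>\<^bsub>F\<^esub>)"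

definition pg_points :: "'a ring \<Rightarrow> 'a triple set set" where
  "pg_points F = {{tscale F a u | a. a \<in> carrier F} | u. u \<in> triples F \<and> u \<noteq> tzero F}"

definition pg_lines :: "'a ring \<Rightarrow> 'a triple set set" where
  "pg_lines F =
     {{tadd F (tscale F a u) (tscale F b w) | a b. a \<in> carrier F \<and> b \<in> carrier F} | u w.
        u \<in> triples F \<and> w \<in> triples F \<and> independent_pair F u w}"


section \<open>Conics and their polarities\<close>

text \<open>
  A conic is given by the six coefficients \<open>(a, b, c, f, g, h)\<close> of its ternary quadratic form
  \<open>a x\<^sup>2 + b y\<^sup>2 + c z\<^sup>2 + f y z + g x z + h x y\<close>.
\<close>

type_synonym 'a conic_coeffs = "'a \<times> 'a \<times> 'a \<times> 'a \<times> 'a \<times> 'a"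

definition conic_coeffs :: "'a ring \<Rightarrow> 'a conic_coeffs set" where
  "conic_coeffs F =
     carrier F \<times> carrier F \<times> carrier F \<times> carrier F \<times> carrier F \<times> carrier F"

fun qform :: "'a ring \<Rightarrow> 'a conic_coeffs \<Rightarrow> 'a triple \<Rightarrow> 'a" where
  "qform F (a, b, c, f, g, h) (x, y, z) =
     a \<otimes>\<^bsub>F\<^esub> (x \<otimes>\<^bsub>F\<^esub> x) \<oplus>\<^bsub>F\<^esub> b \<otimes>\<^bsub>F\<^esub> (y \<otimes>\<^bsub>F\<^esub> y) \<oplus>\<^bsub>F\<^esub> c \<otimes>\<^bsub>F\<^esub> (z \<otimes>\<^bsub>F\<^esub> z) \<oplus>\<^bsub>F\<^esub>
     f \<otimes>\<^bsub>F\<^esub> (y \<otimes>\<^bsub>F\<^esub> z) \<oplus>\<^bsub>F\<^esub> g \<otimes>\<^bsub>F\<^esub> (x \<otimes>\<^bsub>F\<^esub> z) \<oplus>\<^bsub>F\<^esub> h \<otimes>\<^bsub>F\<^esub> (x \<otimes>\<^bsub>F\<^esub> y)"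

definition polar_form :: "'a ring \<Rightarrow> 'a conic_coeffs \<Rightarrow> 'a triple \<Rightarrow> 'a triple \<Rightarrow> 'a" where
  "polar_form F Q u w = qform F Q (tadd F u w) \<ominus>\<^bsub>F\<^esub> qform F Q u \<ominus>\<^bsub>F\<^esub> qform F Q w"

text \<open>
  Triviality of the radical of the polar form is the right notion of non-degeneracy only in
  odd characteristic, where every use below takes place.
\<close>

definition nondegenerate_conic :: "'a ring \<Rightarrow> 'a conic_coeffs \<Rightarrow> bool" where
  "nondegenerate_conic F Q \<longleftrightarrow>
     Q \<in> conic_coeffs F \<and>
     (\<forall>u\<in>triples F. (\<forall>w\<in>triples F. polar_form F Q u w = \<zero>\<^bsub>F\<^esub>) \<longrightarrow> u = tzero F)"

definition conic_points :: "'a ring \<Rightarrow> 'a conic_coeffs \<Rightarrow> 'a triple set set" where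
  "conic_points F Q = {P \<in> pg_points F. \<forall>u\<in>P. qform F Q u = \<zero>\<^bsub>F\<^esub>}"

definition polarity :: "'a ring \<Rightarrow> 'a conic_coeffs \<Rightarrow> 'a triple set \<Rightarrow> 'a triple set" where
  "polarity F Q U = {w \<in> triples F. \<forall>u\<in>U. polar_form F Q u w = \<zero>\<^bsub>F\<^esub>}"

definition external_lines :: "'a ring \<Rightarrow> 'a conic_coeffs \<Rightarrow> 'a triple set set" where
  "external_lines F Q = {l \<in> pg_lines F. \<not> (\<exists>P\<in>conic_points F Q. P \<subseteq> l)}"

definition polar_conjugate ::
  "'a ring \<Rightarrow> 'a conic_coeffs \<Rightarrow> 'a triple set \<Rightarrow> 'a triple set \<Rightarrow> bool" where
  "polar_conjugate F Q l m \<longleftrightarrow> l \<noteq> m \<and> polarity F Q l \<subseteq> m"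


section \<open>Edge-regular graphs and the two clique bounds\<close>

definition edge_regular ::
  "'v set \<Rightarrow> ('v \<Rightarrow> 'v \<Rightarrow> bool) \<Rightarrow> nat \<Rightarrow> nat \<Rightarrow> nat \<Rightarrow> bool" where
  "edge_regular V adj v k l \<longleftrightarrow>
     finite V \<and> (\<forall>a\<in>V. \<not> adj a a) \<and> (\<forall>a\<in>V. \<forall>b\<in>V. adj a b \<longrightarrow> adj b a) \<and>
     card V = v \<and>
     (\<forall>a\<in>V. card {b \<in> V. adj a b} = k) \<and>
     (\<forall>a\<in>V. \<forall>b\<in>V. adj a b \<longrightarrow> card {c \<in> V. adj a c \<and> adj b c} = l)"

definition clique_adjacency_poly :: "nat \<Rightarrow> nat \<Rightarrow> nat \<Rightarrow> int \<Rightarrow> int \<Rightarrow> int" where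
  "clique_adjacency_poly v k l x s =
     x * (x + 1) * (int v - s) - 2 * x * s * (int k - s + 1) + s * (s - 1) * (int l - s + 2)"

text \<open>The least element exists: at \<open>x = 0\<close> and \<open>s = l + 3\<close> the polynomial is negative.\<close>

definition CAP_bound :: "nat \<Rightarrow> nat \<Rightarrow> nat \<Rightarrow> nat" where
  "CAP_bound v k l =
     (LEAST t. \<exists>s\<ge>2. t = s - 1 \<and> (\<exists>x::int. clique_adjacency_poly v k l x (int s) < 0))"

text \<open>
  The vertices are enumerated in an arbitrary order; the spectrum does not depend on it.
  The adjacency matrix of an undirected graph is symmetric, so all its eigenvalues are real.
\<close>

definition adjacency_matrix :: "'v set \<Rightarrow> ('v \<Rightarrow> 'v \<Rightarrow> bool) \<Rightarrow> real mat" where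
  "adjacency_matrix V adj =
     (let vs = (SOME vs. distinct vs \<and> set vs = V)
      in mat (length vs) (length vs) (\<lambda>(i, j). if adj (vs ! i) (vs ! j) then 1 else 0))"

definition min_eigenvalue :: "'v set \<Rightarrow> ('v \<Rightarrow> 'v \<Rightarrow> bool) \<Rightarrow> real" where
  "min_eigenvalue V adj = Min (spectrum (adjacency_matrix V adj))"

text \<open>Here \<open>k\<close> is the valency of the graph.\<close>

definition Delsarte_bound :: "'v set \<Rightarrow> ('v \<Rightarrow> 'v \<Rightarrow> bool) \<Rightarrow> nat \<Rightarrow> real" where
  "Delsarte_bound V adj k = 1 - real k / min_eigenvalue V adj"

end

theory Submission
  imports
    Defs
    "HOL-Algebra.Multiplicative_Group"
    "HOL-Algebra.Weak_Morphisms"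
    "HOL-Number_Theory.Residues"
begin

text \<open>
  Take \<open>q\<close> to be an odd prime dividing some \<open>n\<^sup>2 + 1\<close>, so that \<open>-1\<close> is a square in \<open>F\<close>. Two
  conjugate points on an external line then lie on different sides of the conic: exactly one of
  them is the pole of an external line. Hence the graph is triangle-free of valency
  \<open>k = (q + 1) / 2\<close>, and evaluating the clique adjacency polynomial at \<open>x = 0\<close>, \<open>s = 3\<close> bounds the
  CAP bound by \<open>2\<close>. The Delsarte bound exceeds \<open>2\<close> as soon as the least eigenvalue is negative (the
  trace is zero) and different from \<open>-k\<close>. Two distinct vertices have at most one common neighbour,
  so an eigenvalue \<open>-k\<close> would produce a bipartite component with at least \<open>2 (k\<^sup>2 - k + 1)\<close> vertices,
  which is more than the at most \<open>(q\<^sup>2 + 1) / 2\<close> vertices available.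
\<close>

section \<open>Spectra of regular graphs\<close>

text \<open>The spectrum is never computed: for \<open>g < 0\<close>, the number
  \<open>1 - k / g\<close> exceeds \<open>2\<close> as soon as \<open>- k < g\<close>, so crude
  information on the least eigenvalue is enough. An upper bound on the number of vertices is enough
  as well, but there is hardly any slack: for q = 2 m + 1 the bound is 2 m^2 + 2 m + 1, one less
  than the size 2 m^2 + 2 m + 2 forced by an eigenvalue \<open>-k\<close>. A binary form with
  diagonal values a, b is anisotropic iff -ab is a nonsquare. When -1 is a square the sign
  disappears, and for three pairwise orthogonal vectors with values a, b, c the products ab, ac, bc
  multiply to a square, so they cannot all be nonsquares. This is what keeps triangles out. Asking
  for a divisor of n^2 + 1 supplies the root of -1 directly, as the multiple n of the unit, and
  leaves the infinitude of such primes to Euclid's argument. External lines are handled through the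
  vectors spanning their poles, and dimension arguments are replaced by counting vectors over the
  finite field.\<close>

lemma trace_mult_comm:
  fixes A B :: "'a :: comm_semiring_0 mat"
  assumes A: "A \<in> carrier_mat n n" and B: "B \<in> carrier_mat n n"
  shows "(\<Sum>i<n. (A * B) $$ (i, i)) = (\<Sum>i<n. (B * A) $$ (i, i))"
proof -
  have "(\<Sum>i<n. (A * B) $$ (i, i)) = (\<Sum>i<n. \<Sum>j<n. A $$ (i, j) * B $$ (j, i))"
    using A B by (intro sum.cong) (auto simp: scalar_prod_def atLeast0LessThan)
  also have "\<dots> = (\<Sum>j<n. \<Sum>i<n. A $$ (i, j) * B $$ (j, i))"
    by (rule sum.swap)
  also have "\<dots> = (\<Sum>j<n. (B * A) $$ (j, j))"
    using A B by (intro sum.cong) (auto simp: scalar_prod_def atLeast0LessThan mult.commute)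
  finally show ?thesis .
qed

text \<open>Schur decomposition: \<open>A\<close> is conjugate to a triangular matrix with diagonal
  \<open>es\<close>, and the trace is unchanged under cyclic permutation of factors.\<close>

lemma sum_roots_char_poly:
  fixes A :: "complex mat"
  assumes A: "A \<in> carrier_mat n n" and es: "char_poly A = (\<Prod>e\<leftarrow>es. [:- e, 1:])"
  shows "sum_list es = (\<Sum>i<n. A $$ (i, i))"
proof -
  obtain T P P' where "schur_decomposition A es = (T, P, P')"
    by (cases "schur_decomposition A es")
  then have sim: "similar_mat_wit A T P P'" and diag: "diag_mat T = es"
    using schur_decomposition[OF A es] by blast+
  note D = similar_mat_witD2[OF A sim]
  have "(\<Sum>i<n. A $$ (i, i)) = (\<Sum>i<n. (P * (T * P')) $$ (i, i))"
    using D by (simp add: assoc_mult_mat[of P n n T n P' n])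
  also have "\<dots> = (\<Sum>i<n. ((T * P') * P) $$ (i, i))"
    using D by (intro trace_mult_comm) auto
  also have "(T * P') * P = T"
    using D by (simp add: assoc_mult_mat[of T n n P' n P n])
  also have "(\<Sum>i<n. T $$ (i, i)) = sum_list es"
    using D unfolding diag[symmetric] diag_mat_def
    by (simp add: sum_list_sum_nth atLeast0LessThan)
  finally show ?thesis ..
qed

text \<open>The Hermitian product \<open>S\<close> of \<open>A v\<close> with \<open>v\<close>
  equals \<open>e\<close> times the squared norm \<open>R\<close> of \<open>v\<close>; by symmetry
  \<open>S\<close> is its own conjugate.\<close>

lemma symmetric_eigenvalue_real:
  fixes A :: "real mat"
  assumes A: "A \<in> carrier_mat n n"
    and sym: "\<And>i j. i < n \<Longrightarrow> j < n \<Longrightarrow> A $$ (i, j) = A $$ (j, i)"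
    and e: "eigenvalue (map_mat complex_of_real A) e"
  shows "e \<in> \<real>"
proof -
  obtain v where v: "v \<in> carrier_vec n" "v \<noteq> 0\<^sub>v n" "map_mat complex_of_real A *\<^sub>v v = e \<cdot>\<^sub>v v"
    using e A by (auto simp: eigenvalue_def eigenvector_def)
  have row: "(\<Sum>j<n. complex_of_real (A $$ (i, j)) * v $ j) = e * v $ i" if "i < n" for i
  proof -
    have "(map_mat complex_of_real A *\<^sub>v v) $ i = e * v $ i" using v that by simp
    then show ?thesis using that A v(1) by (simp add: scalar_prod_def atLeast0LessThan)
  qed
  define S where "S = (\<Sum>i<n. \<Sum>j<n. complex_of_real (A $$ (i, j)) * v $ j * cnj (v $ i))"
  define R where "R = (\<Sum>i<n. (cmod (v $ i))\<^sup>2)"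
  have "S = (\<Sum>i<n. e * v $ i * cnj (v $ i))"
    unfolding S_def using row by (simp add: sum_distrib_right[symmetric])
  also have "\<dots> = e * complex_of_real R"
    unfolding R_def of_real_sum complex_norm_square by (simp add: sum_distrib_left mult.assoc)
  finally have S: "S = e * complex_of_real R" .
  have "cnj S = (\<Sum>i<n. \<Sum>j<n. complex_of_real (A $$ (i, j)) * v $ i * cnj (v $ j))"
    by (simp add: S_def mult_ac)
  also have "\<dots> = (\<Sum>j<n. \<Sum>i<n. complex_of_real (A $$ (i, j)) * v $ i * cnj (v $ j))"
    by (rule sum.swap)
  also have "\<dots> = S"
    unfolding S_def using sym by (intro sum.cong refl) simp_all
  finally have "S \<in> \<real>" by (simp add: Reals_cnj_iff)
  obtain i where "i < n" "v $ i \<noteq> 0"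
    using v(1,2) by (metis carrier_vecD eq_vecI index_zero_vec)
  then have "R > 0"
    unfolding R_def by (intro sum_pos2[where i = i]) auto
  then have "e = S / complex_of_real R" using S by simp
  then show ?thesis using \<open>S \<in> \<real>\<close> by (simp add: Reals_divide)
qed

text \<open>Over the complex numbers the characteristic polynomial splits, and its roots are real.
  If none were negative, roots with sum zero would all vanish, against the nonzero root
  \<open>k\<close>.\<close>

lemma symmetric_trace_zero_negative_eigenvalue:
  fixes A :: "real mat"
  assumes A: "A \<in> carrier_mat n n"
    and sym: "\<And>i j. i < n \<Longrightarrow> j < n \<Longrightarrow> A $$ (i, j) = A $$ (j, i)"
    and trace: "(\<Sum>i<n. A $$ (i, i)) = 0"
    and k: "eigenvalue A k" "k \<noteq> 0"
  shows "\<exists>e<0. eigenvalue A e"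
proof (rule ccontr)
  assume neg: "\<not> (\<exists>e<0. eigenvalue A e)"
  let ?A = "map_mat complex_of_real A"
  have cA: "?A \<in> carrier_mat n n" using A by simp
  obtain es where es: "char_poly ?A = (\<Prod>e\<leftarrow>es. [:- e, 1:])"
    using char_poly_factorized[OF cA] by blast
  have root: "poly (char_poly ?A) (complex_of_real x) = complex_of_real (poly (char_poly A) x)" for x
    unfolding of_real_hom.char_poly_hom[OF A] by (rule of_real_hom.poly_map_poly)
  have mem: "e \<in> set es \<longleftrightarrow> poly (char_poly ?A) e = 0" for e
    unfolding es by (simp add: poly_prod_list_zero_iff)
  have nonneg: "Re e \<ge> 0 \<and> Im e = 0" if "e \<in> set es" for e
  proof -
    have "eigenvalue ?A e" using that mem eigenvalue_root_char_poly[OF cA] by simp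
    then have "e \<in> \<real>" using symmetric_eigenvalue_real[OF A sym] by blast
    then have e: "e = complex_of_real (Re e)" by simp
    then have "complex_of_real (poly (char_poly A) (Re e)) = 0"
      using that mem root[of "Re e"] by metis
    then have "eigenvalue A (Re e)" using eigenvalue_root_char_poly[OF A] by simp
    then show ?thesis using neg e by (metis Im_complex_of_real not_less)
  qed
  have "sum_list es = (\<Sum>i<n. complex_of_real (A $$ (i, i)))"
    using sum_roots_char_poly[OF cA es] A by simp
  also have "\<dots> = 0" using trace by (simp flip: of_real_sum)
  finally have "sum_list es = 0" .
  moreover have "sum_list (map Re xs) = Re (sum_list xs)" for xs by (induction xs) simp_all
  ultimately have "sum_list (map Re es) = 0" by simp
  then have "\<forall>x\<in>set (map Re es). x = 0"
    using nonneg by (subst sum_list_nonneg_eq_0_iff[symmetric]) auto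
  moreover have "complex_of_real k \<in> set es"
    using mem root[of k] k(1) eigenvalue_root_char_poly[OF A] by simp
  ultimately show False using k(2) by auto
qed

section \<open>Adjacency matrices of regular graphs\<close>

lemma adjacency_matrix_nth:
  assumes "finite V"
  obtains vs where "distinct vs" "set vs = V"
    "adjacency_matrix V adj = mat (length vs) (length vs) (\<lambda>(i, j). if adj (vs ! i) (vs ! j) then 1 else 0)"
proof -
  define vs where "vs = (SOME vs. distinct vs \<and> set vs = V)"
  have "\<exists>vs. distinct vs \<and> set vs = V" using finite_distinct_list[OF assms] by blast
  then have "distinct vs \<and> set vs = V" unfolding vs_def by (rule someI_ex)
  then show ?thesis using that[of vs] by (simp add: adjacency_matrix_def vs_def Let_def)
qed

lemma sum_nth_adjacent:
  fixes x :: "'v \<Rightarrow> real"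
  assumes vs: "distinct vs" "set vs = V"
  shows "(\<Sum>j<length vs. (if adj a (vs ! j) then 1 else 0) * x (vs ! j)) = (\<Sum>b\<in>{b \<in> V. adj a b}. x b)"
proof -
  have "(\<Sum>j<length vs. (if adj a (vs ! j) then 1 else 0) * x (vs ! j)) = (\<Sum>b\<in>V. (if adj a b then 1 else 0) * x b)"
    using sum.reindex_bij_betw[OF bij_betw_nth[OF vs(1) refl vs(2)[symmetric]],
      where g = "\<lambda>b. (if adj a b then 1 else 0) * x b"] .
  also have "\<dots> = (\<Sum>b\<in>V. if adj a b then x b else 0)" by (intro sum.cong) auto
  also have "\<dots> = (\<Sum>b\<in>{b \<in> V. adj a b}. x b)"
    using vs(2) by (intro sum.inter_filter[symmetric]) auto
  finally show ?thesis .
qed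

text \<open>Turns an eigenvector indexed by positions into a function on vertices, so that later
  arguments no longer see the chosen enumeration.\<close>

lemma spectrum_adjacency_matrixD:
  assumes fin: "finite V" and e: "e \<in> spectrum (adjacency_matrix V adj)"
  obtains x where "\<exists>a\<in>V. x a \<noteq> (0::real)" "\<And>a. a \<in> V \<Longrightarrow> (\<Sum>b\<in>{b \<in> V. adj a b}. x b) = e * x a"
proof -
  obtain vs where vs: "distinct vs" "set vs = V"
    and A: "adjacency_matrix V adj = mat (length vs) (length vs) (\<lambda>(i, j). if adj (vs ! i) (vs ! j) then 1 else 0)"
    (is "_ = ?A") using adjacency_matrix_nth[OF fin] by blast
  let ?n = "length vs"
  obtain v where v: "v \<in> carrier_vec ?n" "v \<noteq> 0\<^sub>v ?n" "?A *\<^sub>v v = e \<cdot>\<^sub>v v"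
    using e unfolding A by (auto simp: spectrum_def eigenvalue_def eigenvector_def)
  define x where "x a = v $ (the_inv_into {..<?n} ((!) vs) a)" for a
  have inj: "inj_on ((!) vs) {..<?n}" using vs(1) by (auto simp: inj_on_def nth_eq_iff_index_eq)
  have x: "x (vs ! i) = v $ i" if "i < ?n" for i
    using the_inv_into_f_f[OF inj] that by (simp add: x_def)
  show ?thesis
  proof (rule that)
    obtain i where i: "i < ?n" "v $ i \<noteq> 0"
      using v(1,2) by (metis carrier_vecD eq_vecI index_zero_vec)
    then have "x (vs ! i) \<noteq> 0" "vs ! i \<in> V" using x vs by auto
    then show "\<exists>a\<in>V. x a \<noteq> 0" by blast
    fix a assume "a \<in> V"
    then obtain i where i: "i < ?n" "a = vs ! i" using vs by (metis in_set_conv_nth)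
    have "(?A *\<^sub>v v) $ i = e * x a" using v i x by simp
    moreover have "(?A *\<^sub>v v) $ i = (\<Sum>j<?n. (if adj a (vs ! j) then 1 else 0) * x (vs ! j))"
      using i v(1) x by (simp add: scalar_prod_def atLeast0LessThan)
    ultimately show "(\<Sum>b\<in>{b \<in> V. adj a b}. x b) = e * x a"
      using sum_nth_adjacent[OF vs, where adj = adj and a = a and x = x] by simp
  qed
qed

text \<open>The all-ones vector is an eigenvector. This is the nonzero eigenvalue that the trace
  argument requires.\<close>

lemma edge_regular_valency_eigenvalue:
  assumes reg: "edge_regular V adj v k l" and ne: "V \<noteq> {}"
  shows "eigenvalue (adjacency_matrix V adj) (real k)"
proof -
  have fin: "finite V" and deg: "\<And>a. a \<in> V \<Longrightarrow> card {b \<in> V. adj a b} = k"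
    using reg by (auto simp: edge_regular_def)
  obtain vs where vs: "distinct vs" "set vs = V"
    and A: "adjacency_matrix V adj = mat (length vs) (length vs) (\<lambda>(i, j). if adj (vs ! i) (vs ! j) then 1 else 0)"
    (is "_ = ?A") using adjacency_matrix_nth[OF fin] by blast
  let ?n = "length vs" and ?v = "vec (length vs) (\<lambda>_. 1 :: real)"
  have "?n > 0" using vs ne by auto
  have "eigenvector ?A ?v (real k)"
    unfolding eigenvector_def
  proof (intro conjI)
    show "?v \<noteq> 0\<^sub>v (dim_row ?A)"
    proof
      assume "?v = 0\<^sub>v (dim_row ?A)"
      then have "?v $ 0 = 0\<^sub>v ?n $ 0" by simp
      then show False using \<open>?n > 0\<close> by simp
    qed
    show "?A *\<^sub>v ?v = real k \<cdot>\<^sub>v ?v"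
    proof (rule eq_vecI)
      fix i assume "i < dim_vec (real k \<cdot>\<^sub>v ?v)"
      then have i: "i < ?n" by simp
      then have "(?A *\<^sub>v ?v) $ i = (\<Sum>j<?n. (if adj (vs ! i) (vs ! j) then 1 else 0) * 1)"
        by (simp add: scalar_prod_def atLeast0LessThan)
      also have "\<dots> = real k"
        using sum_nth_adjacent[OF vs, where x = "\<lambda>_. 1" and adj = adj and a = "vs ! i"] deg[of "vs ! i"] nth_mem[OF i] vs(2) by simp
      finally show "(?A *\<^sub>v ?v) $ i = (real k \<cdot>\<^sub>v ?v) $ i" using i by simp
    qed simp
  qed simp
  then show ?thesis unfolding A eigenvalue_def by blast
qed

lemma edge_regular_negative_eigenvalue:
  assumes reg: "edge_regular V adj v k l" and ne: "V \<noteq> {}" and k: "k > 0"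
  shows "\<exists>e<0. eigenvalue (adjacency_matrix V adj) e"
proof -
  have fin: "finite V" and irrefl: "\<And>a. a \<in> V \<Longrightarrow> \<not> adj a a"
    and symm: "\<And>a b. a \<in> V \<Longrightarrow> b \<in> V \<Longrightarrow> adj a b \<longleftrightarrow> adj b a"
    using reg by (auto simp: edge_regular_def)
  obtain vs where vs: "distinct vs" "set vs = V"
    and A: "adjacency_matrix V adj = mat (length vs) (length vs) (\<lambda>(i, j). if adj (vs ! i) (vs ! j) then 1 else 0)"
    using adjacency_matrix_nth[OF fin] by blast
  have mem: "vs ! i \<in> V" if "i < length vs" for i using that vs by auto
  show ?thesis
  proof (rule symmetric_trace_zero_negative_eigenvalue)
    show "adjacency_matrix V adj \<in> carrier_mat (length vs) (length vs)" by (simp add: A)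
    show "eigenvalue (adjacency_matrix V adj) (real k)"
      using edge_regular_valency_eigenvalue[OF reg ne] .
  qed (use mem irrefl symm k in \<open>auto simp: A\<close>)
qed

section \<open>Excluding the eigenvalue \<open>-k\<close>\<close>

definition C4_free :: "'v set \<Rightarrow> ('v \<Rightarrow> 'v \<Rightarrow> bool) \<Rightarrow> bool" where
  "C4_free V adj \<longleftrightarrow>
     (\<forall>a\<in>V. \<forall>b\<in>V. \<forall>c\<in>V. \<forall>d\<in>V. a \<noteq> b \<and> adj a c \<and> adj b c \<and> adj a d \<and> adj b d \<longrightarrow> c = d)"

text \<open>Each of the \<open>k\<close> neighbours \<open>b\<close> of \<open>a\<close> contributes
  \<open>k - 1\<close> vertices other than \<open>a\<close>. These contributions are disjoint, since
  a shared vertex \<open>c\<close> and \<open>a\<close> would be two common neighbours of distinct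
  vertices. The final \<open>1\<close> is \<open>a\<close> itself. The set \<open>S\<close> is any
  finite set containing \<open>a\<close> and the ends of the two-step walks from
  \<open>a\<close>.\<close>

lemma C4_free_ball_card:
  assumes reg: "edge_regular V adj v k 0" and a: "a \<in> V"
    and c4: "C4_free V adj"
    and S: "finite S" "a \<in> S" "\<And>b c. \<lbrakk>b \<in> V; c \<in> V; adj a b; adj b c\<rbrakk> \<Longrightarrow> c \<in> S"
  shows "k * (k - 1) + 1 \<le> card S"
proof -
  have fin: "finite V"
    and symm: "\<And>a b. a \<in> V \<Longrightarrow> b \<in> V \<Longrightarrow> adj a b \<longleftrightarrow> adj b a"
    and deg: "\<And>a. a \<in> V \<Longrightarrow> card {b \<in> V. adj a b} = k"
    using reg by (auto simp: edge_regular_def)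
  let ?N = "\<lambda>a. {b \<in> V. adj a b}"
  let ?T = "\<Union>b\<in>?N a. ?N b - {a}"
  have "card ?T = (\<Sum>b\<in>?N a. card (?N b - {a}))"
  proof (rule card_UN_disjoint)
    show "\<forall>b\<in>?N a. \<forall>b'\<in>?N a. b \<noteq> b' \<longrightarrow> (?N b - {a}) \<inter> (?N b' - {a}) = {}"
    proof (intro ballI impI, rule ccontr)
      fix b b' assume b: "b \<in> ?N a" "b' \<in> ?N a" "b \<noteq> b'" and "(?N b - {a}) \<inter> (?N b' - {a}) \<noteq> {}"
      then obtain c where "c \<in> V" "c \<noteq> a" "adj b c" "adj b' c" by blast
      then show False using c4 b a symm unfolding C4_free_def by blast
    qed
  qed (use fin in auto)
  also have "\<dots> = (\<Sum>b\<in>?N a. k - 1)"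
    using deg symm a fin by (intro sum.cong refl) auto
  also have "\<dots> = k * (k - 1)" using deg[OF a] by simp
  finally have "k * (k - 1) + 1 = card (insert a ?T)"
    using fin by (subst card_insert_disjoint) auto
  also have "\<dots> \<le> card S" using S(2,3) by (intro card_mono[OF S(1)]) blast
  finally show ?thesis .
qed

text \<open>Maximum modulus argument: where an eigenfunction for \<open>e \<le> - k\<close> attains
  its largest absolute value, all neighbours carry the opposite value. The sign pattern propagates
  and yields two disjoint vertex sets, each containing a ball of radius two on one side of a
  bipartition.\<close>

lemma eigenvalue_gt_minus_valency:
  assumes reg: "edge_regular V adj v k 0" and k: "k > 0"
    and c4: "C4_free V adj"
    and small: "v < 2 * (k * (k - 1) + 1)"
    and e: "e \<in> spectrum (adjacency_matrix V adj)"
  shows "- real k < e"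
proof (rule ccontr)
  assume "\<not> - real k < e"
  then have le: "e \<le> - real k" by simp
  have fin: "finite V" and v: "card V = v"
    and deg: "\<And>a. a \<in> V \<Longrightarrow> card {b \<in> V. adj a b} = k"
    using reg by (auto simp: edge_regular_def)
  obtain x where x: "\<exists>a\<in>V. x a \<noteq> (0::real)"
    "\<And>a. a \<in> V \<Longrightarrow> (\<Sum>b\<in>{b \<in> V. adj a b}. x b) = e * x a"
    using spectrum_adjacency_matrixD[OF fin e] by blast
  define M where "M = Max ((\<lambda>a. \<bar>x a\<bar>) ` V)"
  have M: "\<bar>x a\<bar> \<le> M" if "a \<in> V" for a using that fin by (simp add: M_def)
  obtain c where "c \<in> V" "x c \<noteq> 0" using x(1) by blast
  then have Mpos: "M > 0" using M[of c] by simp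
  have "M \<in> (\<lambda>a. \<bar>x a\<bar>) ` V" unfolding M_def using fin x(1) by (intro Max_in) auto
  then obtain a where a: "a \<in> V" "\<bar>x a\<bar> = M" by blast
  \<comment> \<open>Equality case of an estimate: every neighbour \<open>d\<close> of
    \<open>c\<close> has \<open>s * x d \<ge> - M\<close>, and these \<open>k\<close> numbers add up
    to \<open>e * M \<le> - k * M\<close>, so none of the inequalities can be strict.\<close>
  have step: "x b = - s * M" if s: "s = 1 \<or> s = -1" and c: "c \<in> V" "x c = s * M" "b \<in> V" "adj c b" for s b c
  proof (rule ccontr)
    assume ne: "x b \<noteq> - s * M"
    have ss: "s * s = 1" using s by auto
    have ge: "- M \<le> s * x d" if "d \<in> V" for d using M[OF that] s by auto
    have "s * x b \<noteq> - M" using ne s by auto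
    then have gt: "- M < s * x b" using ge[OF c(3)] by simp
    have "(\<Sum>d\<in>{d \<in> V. adj c d}. - M) < (\<Sum>d\<in>{d \<in> V. adj c d}. s * x d)"
      using fin c gt ge by (intro sum_strict_mono_ex1) auto
    also have "\<dots> = s * (e * x c)" using x(2)[OF c(1)] by (simp add: sum_distrib_left[symmetric])
    also have "\<dots> = e * M" using c(2) ss by (simp add: algebra_simps)
    also have "\<dots> \<le> - real k * M" using le Mpos by (intro mult_right_mono) auto
    finally show False using deg[OF c(1)] by simp
  qed
  obtain s :: real where s: "s = 1 \<or> s = -1" "x a = s * M"
    using a(2) that[of 1] that[of "-1"] by (cases "x a < 0") auto
  have s': "- s = 1 \<or> - s = -1" using s(1) by auto
  have "{b \<in> V. adj a b} \<noteq> {}"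
  proof
    assume "{b \<in> V. adj a b} = {}"
    then have "card {b \<in> V. adj a b} = 0" by (simp only: card.empty)
    then show False using deg[OF a(1)] k by simp
  qed
  then obtain b where b: "b \<in> V" "adj a b" by blast
  have xb: "x b = - s * M" using step[OF s(1) a(1) s(2) b] .
  \<comment> \<open>Two-step walks from \<open>a\<close> end in \<open>?P\<close>, those from its
    neighbour \<open>b\<close> in \<open>?N\<close>; since \<open>M > 0\<close> the two sets are
    disjoint.\<close>
  let ?P = "{c \<in> V. x c = s * M}" and ?N = "{c \<in> V. x c = - s * M}"
  have "k * (k - 1) + 1 \<le> card ?P"
  proof (rule C4_free_ball_card[OF reg a(1) c4])
    fix c d assume cd: "c \<in> V" "d \<in> V" "adj a c" "adj c d"
    have "x c = - s * M" using step[OF s(1) a(1) s(2) cd(1,3)] .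
    then have "x d = - (- s) * M" using step[OF s' cd(1) _ cd(2,4)] by blast
    then show "d \<in> ?P" using cd(2) by simp
  qed (use fin a s in auto)
  moreover have "k * (k - 1) + 1 \<le> card ?N"
  proof (rule C4_free_ball_card[OF reg b(1) c4])
    fix c d assume cd: "c \<in> V" "d \<in> V" "adj b c" "adj c d"
    have "x c = - (- s) * M" using step[OF s' b(1) xb cd(1,3)] .
    then have "x c = s * M" by simp
    then have "x d = - s * M" using step[OF s(1) cd(1) _ cd(2,4)] by blast
    then show "d \<in> ?N" using cd(2) by simp
  qed (use fin b xb in auto)
  moreover have "card ?P + card ?N \<le> card V"
  proof -
    have "?P \<inter> ?N = {}" using Mpos s(1) by auto
    then have "card ?P + card ?N = card (?P \<union> ?N)" using fin by (simp add: card_Un_disjoint)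
    also have "\<dots> \<le> card V" using fin by (intro card_mono) auto
    finally show ?thesis .
  qed
  ultimately show False using small v by simp
qed

section \<open>Comparison of the two clique bounds\<close>

text \<open>At \<open>x = 0\<close> only the last summand survives, and \<open>s = l + 3\<close>
  makes its factor \<open>l - s + 2\<close> equal to -1. This is the elementary bound: an edge of an
  s-clique has at least s - 2 common neighbours.\<close>

lemma CAP_bound_le: "CAP_bound v k l \<le> l + 2"
  unfolding CAP_bound_def
proof (rule Least_le, intro exI conjI)
  show "clique_adjacency_poly v k l 0 (int (l + 3)) < 0"
    by (simp add: clique_adjacency_poly_def)
qed simp_all

lemma CAP_bound_less_Delsarte_bound:
  assumes reg: "edge_regular V adj v k 0" and ne: "V \<noteq> {}" and k: "k > 0"
    and c4: "C4_free V adj"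
    and small: "v < 2 * (k * (k - 1) + 1)"
  shows "real (CAP_bound v k 0) < Delsarte_bound V adj k"
proof -
  let ?S = "spectrum (adjacency_matrix V adj)"
  define g where "g = min_eigenvalue V adj"
  have "adjacency_matrix V adj \<in> carrier_mat (dim_row (adjacency_matrix V adj)) (dim_row (adjacency_matrix V adj))"
    by (simp add: adjacency_matrix_def Let_def)
  then have fin: "finite ?S" using card_finite_spectrum(1) by blast
  obtain e where e: "e < 0" "e \<in> ?S"
    using edge_regular_negative_eigenvalue[OF reg ne k] by (auto simp: spectrum_def)
  then have "g \<in> ?S" "g \<le> e"
    unfolding g_def min_eigenvalue_def using fin by (auto intro: Min_in)
  then have "g < 0" using e(1) by simp
  moreover have "- real k < g"
    using eigenvalue_gt_minus_valency[OF reg k c4 small \<open>g \<in> ?S\<close>] .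
  ultimately have "2 < 1 - real k / g" by (simp add: field_simps)
  moreover have "real (CAP_bound v k 0) \<le> 2" using CAP_bound_le[of v k 0] by simp
  ultimately show ?thesis by (simp add: Delsarte_bound_def g_def)
qed

section \<open>Squares in finite fields of odd order\<close>

locale odd_finite_field = field F for F :: "('a, 'b) ring_scheme" (structure) +
  assumes finite_carrier: "finite (carrier F)"
    and two_nonzero: "\<one> \<oplus> \<one> \<noteq> \<zero>"
begin

text \<open>Zero counts as a square, so a nonsquare is automatically nonzero.\<close>

definition is_square :: "'a \<Rightarrow> bool" where
  "is_square x \<longleftrightarrow> (\<exists>y\<in>carrier F. x = y \<otimes> y)"

lemma is_square_mult: "is_square a \<Longrightarrow> is_square b \<Longrightarrow> is_square (a \<otimes> b)"
proof -
  assume "is_square a" "is_square b"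
  then obtain y z where "y \<in> carrier F" "z \<in> carrier F" "a = y \<otimes> y" "b = z \<otimes> z"
    by (auto simp: is_square_def)
  then have "a \<otimes> b = (y \<otimes> z) \<otimes> (y \<otimes> z)" by (simp add: m_ac)
  then show ?thesis
    using \<open>y \<in> carrier F\<close> \<open>z \<in> carrier F\<close> unfolding is_square_def by blast
qed

lemma is_square_cancel:
  assumes "is_square c" "c \<noteq> \<zero>" "a \<in> carrier F" "is_square (c \<otimes> a)"
  shows "is_square a"
proof -
  obtain z where z: "z \<in> carrier F" "c = z \<otimes> z" using assms(1) by (auto simp: is_square_def)
  obtain y where y: "y \<in> carrier F" "c \<otimes> a = y \<otimes> y" using assms(4) by (auto simp: is_square_def)
  have nz: "z \<noteq> \<zero>" using z assms(2) by auto
  then have i: "inv z \<in> carrier F" "inv z \<otimes> z = \<one>" using z field_Units by simp_all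
  have "a = (inv z \<otimes> z) \<otimes> (inv z \<otimes> z) \<otimes> a" using i(2) assms(3) by simp
  also have "\<dots> = inv z \<otimes> inv z \<otimes> (c \<otimes> a)"
    unfolding z(2) using i(1) z(1) assms(3) by (simp add: m_ac)
  also have "\<dots> = (inv z \<otimes> y) \<otimes> (inv z \<otimes> y)"
    unfolding y(2) using i(1) y(1) by (simp add: m_ac)
  finally show ?thesis
    using i(1) y(1) unfolding is_square_def by blast
qed

lemma neg_neq:
  assumes "y \<in> carrier F" "y \<noteq> \<zero>"
  shows "\<ominus> y \<noteq> y"
proof
  assume "\<ominus> y = y"
  then have "y \<oplus> y = \<zero>" using assms r_neg by metis
  then have "(\<one> \<oplus> \<one>) \<otimes> y = \<zero>" using assms by (simp add: l_distr)
  then show False using assms two_nonzero by (simp add: integral_iff)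
qed

lemma square_eq_iff:
  assumes "x \<in> carrier F" "y \<in> carrier F"
  shows "x \<otimes> x = y \<otimes> y \<longleftrightarrow> x = y \<or> x = \<ominus> y"
proof
  assume "x \<otimes> x = y \<otimes> y"
  moreover have "(x \<ominus> y) \<otimes> (x \<oplus> y) = x \<otimes> x \<ominus> y \<otimes> y"
    using assms by algebra
  ultimately have "(x \<ominus> y) \<otimes> (x \<oplus> y) = \<zero>" using assms by simp
  then have "x \<ominus> y = \<zero> \<or> x \<oplus> y = \<zero>"
    using integral[of "x \<ominus> y" "x \<oplus> y"] assms minus_closed by blast
  then show "x = y \<or> x = \<ominus> y"
  proof
    assume "x \<ominus> y = \<zero>"
    moreover have "x = (x \<ominus> y) \<oplus> y" using assms by algebra
    ultimately show ?thesis using assms by simp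
  qed (use assms minus_equality[of x y] in auto)
qed (use assms in \<open>auto simp: l_minus r_minus\<close>)

text \<open>Squaring identifies the distinct elements 1 and -1, so on a finite set it cannot be
  surjective.\<close>

lemma nonsquare_exists:
  obtains n where "n \<in> carrier F" "\<not> is_square n"
proof -
  have "(\<ominus> \<one>) \<otimes> (\<ominus> \<one>) = \<one> \<otimes> \<one>" "\<ominus> \<one> \<noteq> \<one>"
    using neg_neq[of \<one>] by (simp_all add: l_minus)
  then have "\<not> inj_on (\<lambda>y. y \<otimes> y) (carrier F)"
    unfolding inj_on_def by (metis one_closed a_inv_closed)
  then have "\<not> carrier F \<subseteq> (\<lambda>y. y \<otimes> y) ` carrier F"
    using finite_surj_inj[OF finite_carrier] by blast
  then show ?thesis using that by (auto simp: is_square_def)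
qed

text \<open>The nonzero squares \<open>S\<close> have index two, by counting. Every nonzero element
  is plus or minus the chosen root of its square, so \<open>C\<close> has at most twice as many
  elements as \<open>S\<close>; the disjoint sets \<open>S\<close> and \<open>a S\<close> therefore
  fill \<open>C\<close>. Hence \<open>b = a s\<close>, and \<open>a b\<close> is \<open>a\<close>
  squared times a square.\<close>

lemma is_square_mult_nonsquares:
  assumes a: "a \<in> carrier F" "\<not> is_square a" and b: "b \<in> carrier F" "\<not> is_square b"
  shows "is_square (a \<otimes> b)"
proof -
  define C where "C = carrier F - {\<zero>}"
  define S where "S = {s \<in> C. is_square s}"
  have fin: "finite C" "finite S" using finite_carrier by (simp_all add: C_def S_def)
  have zero: "is_square \<zero>" unfolding is_square_def by (rule bexI[of _ \<zero>]) simp_all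
  define r where "r s = (SOME y. y \<in> carrier F \<and> s = y \<otimes> y)" for s
  have r: "r s \<in> carrier F" "s = r s \<otimes> r s" if "s \<in> S" for s
    using that someI_ex[of "\<lambda>y. y \<in> carrier F \<and> s = y \<otimes> y"]
    by (auto simp: S_def is_square_def r_def)
  have "C \<subseteq> r ` S \<union> (\<lambda>s. \<ominus> r s) ` S"
  proof
    fix y assume y: "y \<in> C"
    then have s: "y \<otimes> y \<in> S" by (auto simp: S_def C_def is_square_def integral_iff)
    then have "y = r (y \<otimes> y) \<or> y = \<ominus> r (y \<otimes> y)"
      using r[OF s] y square_eq_iff[of y "r (y \<otimes> y)"] by (simp add: C_def)
    then show "y \<in> r ` S \<union> (\<lambda>s. \<ominus> r s) ` S" using s by blast
  qed
  then have "card C \<le> card (r ` S) + card ((\<lambda>s. \<ominus> r s) ` S)"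
    using fin by (meson card_mono card_Un_le finite_UnI finite_imageI order_trans)
  also have "\<dots> \<le> card S + card S" using fin by (intro add_mono card_image_le)
  finally have le: "card C \<le> card S + card S" .
  have a0: "a \<noteq> \<zero>" using a zero by auto
  have disj: "S \<inter> (\<lambda>s. a \<otimes> s) ` S = {}"
  proof (rule ccontr)
    assume "S \<inter> (\<lambda>s. a \<otimes> s) ` S \<noteq> {}"
    then obtain s where "s \<in> S" "a \<otimes> s \<in> S" by blast
    then show False
      using is_square_cancel[of s a] a by (auto simp: S_def C_def m_comm)
  qed
  have inj: "inj_on (\<lambda>s. a \<otimes> s) S"
    using a a0 m_lcancel by (auto simp: inj_on_def S_def C_def)
  have "card (S \<union> (\<lambda>s. a \<otimes> s) ` S) = card S + card S"
    using fin disj inj by (simp add: card_Un_disjoint card_image)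
  moreover have "S \<union> (\<lambda>s. a \<otimes> s) ` S \<subseteq> C"
    using a a0 by (auto simp: S_def C_def integral_iff)
  ultimately have "S \<union> (\<lambda>s. a \<otimes> s) ` S = C"
    using le fin by (metis card_seteq)
  moreover have "b \<in> C" "b \<notin> S" using b zero by (auto simp: C_def S_def)
  ultimately obtain s where s: "s \<in> S" "b = a \<otimes> s" by blast
  then have "a \<otimes> b = (a \<otimes> a) \<otimes> s" using a by (simp add: m_ac S_def C_def)
  moreover have "is_square (a \<otimes> a)" using a by (auto simp: is_square_def)
  ultimately show ?thesis using s by (simp add: is_square_mult S_def)
qed

text \<open>The hyperbola \<open>y\<^sup>2 - t\<^sup>2 = s\<close> has at most \<open>|F| - 1\<close> points, and every \<open>t\<close> counted here
  carries two of them.\<close>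

lemma card_nonzero_square_translates:
  assumes s: "s \<in> carrier F" "s \<noteq> \<zero>"
  shows "2 * card {t \<in> carrier F. \<exists>y\<in>carrier F. y \<noteq> \<zero> \<and> t \<otimes> t \<oplus> s = y \<otimes> y} \<le> card (carrier F) - 1"
proof -
  define T where "T = {t \<in> carrier F. \<exists>y\<in>carrier F. y \<noteq> \<zero> \<and> t \<otimes> t \<oplus> s = y \<otimes> y}"
  define H where "H = {(y, t) \<in> carrier F \<times> carrier F. t \<otimes> t \<oplus> s = y \<otimes> y}"
  have "\<forall>t\<in>T. \<exists>y\<in>carrier F. y \<noteq> \<zero> \<and> t \<otimes> t \<oplus> s = y \<otimes> y" by (simp add: T_def)
  then obtain f where f: "\<And>t. t \<in> T \<Longrightarrow> f t \<in> carrier F \<and> f t \<noteq> \<zero> \<and> t \<otimes> t \<oplus> s = f t \<otimes> f t"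
    by metis
  have "H \<subseteq> carrier F \<times> carrier F" by (auto simp: H_def)
  then have fin: "finite T" "finite H"
    using finite_carrier finite_subset by (auto simp: T_def)
  let ?P = "(\<lambda>t. (f t, t)) ` T" and ?N = "(\<lambda>t. (\<ominus> f t, t)) ` T"
  have "?P \<inter> ?N = {}"
    using f neg_neq by fastforce
  then have "card (?P \<union> ?N) = 2 * card T"
    using fin by (simp add: card_Un_disjoint card_image inj_on_def)
  moreover have "card (?P \<union> ?N) \<le> card H"
  proof (rule card_mono[OF fin(2)])
    have "(f t, t) \<in> H \<and> (\<ominus> f t, t) \<in> H" if "t \<in> T" for t
      using f[OF that] that by (auto simp: H_def T_def l_minus r_minus)
    then show "?P \<union> ?N \<subseteq> H" by blast
  qed
  \<comment> \<open>On the hyperbola the product of \<open>y - t\<close> and \<open>y + t\<close> is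
    the nonzero \<open>s\<close>. So \<open>y - t\<close> is nonzero and determines
    \<open>y + t\<close>, hence also \<open>y\<close> and \<open>t\<close>, because 2 is
    invertible.\<close>
  moreover have "card H \<le> card (carrier F - {\<zero>})"
  proof (rule card_inj_on_le[where f = "\<lambda>(y, t). y \<ominus> t"])
    have prod: "(y \<ominus> t) \<otimes> (y \<oplus> t) = s" if "(y, t) \<in> H" for y t
    proof -
      have c: "y \<in> carrier F" "t \<in> carrier F" "t \<otimes> t \<oplus> s = y \<otimes> y" using that by (auto simp: H_def)
      then have "(y \<ominus> t) \<otimes> (y \<oplus> t) = y \<otimes> y \<ominus> t \<otimes> t" by algebra
      also have "\<dots> = s" unfolding c(3)[symmetric] using c(1,2) s(1) by algebra
      finally show ?thesis .
    qed
    show "(\<lambda>(y, t). y \<ominus> t) ` H \<subseteq> carrier F - {\<zero>}"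
      using prod s by (fastforce simp: H_def)
    show "inj_on (\<lambda>(y, t). y \<ominus> t) H"
    proof (clarsimp simp: inj_on_def)
      fix y t y' t' assume h: "(y, t) \<in> H" "(y', t') \<in> H" and e: "y \<ominus> t = y' \<ominus> t'"
      then have c: "y \<in> carrier F" "t \<in> carrier F" "y' \<in> carrier F" "t' \<in> carrier F"
        by (auto simp: H_def)
      have nz: "y \<ominus> t \<noteq> \<zero>"
      proof
        assume "y \<ominus> t = \<zero>"
        then have "s = \<zero> \<otimes> (y \<oplus> t)" using prod[OF h(1)] by simp
        then show False using s c by simp
      qed
      have "(y \<ominus> t) \<otimes> (y \<oplus> t) = (y \<ominus> t) \<otimes> (y' \<oplus> t')"
        using prod[OF h(1)] prod[OF h(2)] e by simp
      then have e2: "y \<oplus> t = y' \<oplus> t'" using nz c m_lcancel by simp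
      have "(\<one> \<oplus> \<one>) \<otimes> y = (y \<oplus> t) \<oplus> (y \<ominus> t)" using c by algebra
      also have "\<dots> = (\<one> \<oplus> \<one>) \<otimes> y'" unfolding e e2 using c by algebra
      finally have "y = y'" using c two_nonzero m_lcancel by simp
      moreover have "t = (y \<oplus> t) \<ominus> y" "t' = (y' \<oplus> t') \<ominus> y'" using c by algebra+
      ultimately show "y = y' \<and> t = t'" using e2 by simp
    qed
  qed (use finite_carrier in simp)
  moreover have "card (carrier F - {\<zero>}) = card (carrier F) - 1"
    using finite_carrier by simp
  ultimately show ?thesis by (simp add: T_def)
qed

end

section \<open>Quadratic forms in three variables\<close>

locale conic_plane = odd_finite_field F for F :: "'a ring" (structure) +
  fixes Q :: "'a conic_coeffs"
  assumes nondegenerate: "nondegenerate_conic F Q"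
    and minus_one_square: "\<exists>i\<in>carrier F. i \<otimes> i = \<ominus> \<one>"
begin

abbreviation add_vec (infixl "\<boxplus>" 65) where "u \<boxplus> w \<equiv> tadd F u w"
abbreviation scale_vec (infixr "\<cdot>" 75) where "c \<cdot> u \<equiv> tscale F c u"
abbreviation "V \<equiv> triples F"
abbreviation "o\<^sub>v \<equiv> tzero F"
abbreviation "q \<equiv> qform F Q"
abbreviation "B \<equiv> polar_form F Q"

section \<open>Vector space laws for triples\<close>

lemma tadd_closed [simp]: "u \<in> V \<Longrightarrow> w \<in> V \<Longrightarrow> u \<boxplus> w \<in> V"
  by (cases u; cases w) (auto simp: triples_def)

lemma tscale_closed [simp]: "c \<in> carrier F \<Longrightarrow> u \<in> V \<Longrightarrow> c \<cdot> u \<in> V"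
  by (cases u) (auto simp: triples_def)

lemma tzero_closed [simp]: "o\<^sub>v \<in> V"
  by (auto simp: triples_def tzero_def)

lemma tadd_tzero [simp]: "u \<in> V \<Longrightarrow> u \<boxplus> o\<^sub>v = u" "u \<in> V \<Longrightarrow> o\<^sub>v \<boxplus> u = u"
  by (cases u; auto simp: triples_def tzero_def)+

lemma tscale_simps [simp]:
  "u \<in> V \<Longrightarrow> \<zero> \<cdot> u = o\<^sub>v" "u \<in> V \<Longrightarrow> \<one> \<cdot> u = u" "c \<in> carrier F \<Longrightarrow> c \<cdot> o\<^sub>v = o\<^sub>v"
  by (cases u; auto simp: triples_def tzero_def)+

lemma tscale_tscale [simp]:
  "a \<in> carrier F \<Longrightarrow> b \<in> carrier F \<Longrightarrow> u \<in> V \<Longrightarrow> a \<cdot> b \<cdot> u = (a \<otimes> b) \<cdot> u"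
  by (cases u) (auto simp: triples_def m_assoc)

lemma tadd_comm: "u \<in> V \<Longrightarrow> w \<in> V \<Longrightarrow> u \<boxplus> w = w \<boxplus> u"
  by (cases u; cases w) (auto simp: triples_def a_comm)

lemma tadd_assoc: "u \<in> V \<Longrightarrow> w \<in> V \<Longrightarrow> x \<in> V \<Longrightarrow> u \<boxplus> w \<boxplus> x = u \<boxplus> (w \<boxplus> x)"
  by (cases u; cases w; cases x) (auto simp: triples_def a_assoc)

lemma tscale_tadd:
  "c \<in> carrier F \<Longrightarrow> u \<in> V \<Longrightarrow> w \<in> V \<Longrightarrow> c \<cdot> (u \<boxplus> w) = c \<cdot> u \<boxplus> c \<cdot> w"
  by (cases u; cases w) (auto simp: triples_def r_distr)

lemma tscale_add:
  "a \<in> carrier F \<Longrightarrow> b \<in> carrier F \<Longrightarrow> u \<in> V \<Longrightarrow> (a \<oplus> b) \<cdot> u = a \<cdot> u \<boxplus> b \<cdot> u"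
  by (cases u) (auto simp: triples_def l_distr)

text \<open>Substitute for subtraction, which triples do not carry: adding a multiple and its
  negative cancels, in the bracketings that occur later.\<close>

lemma tadd_diff:
  assumes "c \<in> carrier F" "u \<in> V" "w \<in> V"
  shows "c \<cdot> u \<boxplus> (w \<boxplus> (\<ominus> c) \<cdot> u) = w" "w \<boxplus> c \<cdot> u \<boxplus> (\<ominus> c) \<cdot> u = w" "c \<cdot> u \<boxplus> w \<boxplus> (\<ominus> c) \<cdot> u = w"
proof -
  have c: "c \<cdot> u \<boxplus> (\<ominus> c) \<cdot> u = o\<^sub>v"
    using assms by (simp add: tscale_add[symmetric] r_neg)
  show 2: "w \<boxplus> c \<cdot> u \<boxplus> (\<ominus> c) \<cdot> u = w"
    using assms c by (simp add: tadd_assoc)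
  then show 3: "c \<cdot> u \<boxplus> w \<boxplus> (\<ominus> c) \<cdot> u = w"
    using assms by (simp add: tadd_comm[of w])
  then show "c \<cdot> u \<boxplus> (w \<boxplus> (\<ominus> c) \<cdot> u) = w"
    using assms by (simp add: tadd_assoc)
qed

lemma tscale_eq_tzero:
  assumes "c \<in> carrier F" "u \<in> V"
  shows "c \<cdot> u = o\<^sub>v \<longleftrightarrow> c = \<zero> \<or> u = o\<^sub>v"
  using assms by (cases u) (auto simp: triples_def tzero_def integral_iff)

lemma card_triples: "card V = card (carrier F) ^ 3"
  by (simp add: triples_def card_cartesian_product power3_eq_cube)

lemma finite_triples [simp]: "finite V"
  using finite_carrier by (simp add: triples_def)

section \<open>The quadratic form and its bilinear polar form\<close>

lemma coeffs_closed: "Q \<in> conic_coeffs F"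
  using nondegenerate by (simp add: nondegenerate_conic_def)

lemma q_closed [simp]: "u \<in> V \<Longrightarrow> q u \<in> carrier F"
  using coeffs_closed by (cases u; cases Q) (auto simp: triples_def conic_coeffs_def)

lemma B_closed [simp]: "u \<in> V \<Longrightarrow> w \<in> V \<Longrightarrow> B u w \<in> carrier F"
  by (simp add: polar_form_def)

lemma q_tscale [simp]: "c \<in> carrier F \<Longrightarrow> u \<in> V \<Longrightarrow> q (c \<cdot> u) = c \<otimes> c \<otimes> q u"
  using coeffs_closed
  by (cases u; cases Q) (auto simp: triples_def conic_coeffs_def r_distr m_ac)

lemma q_tzero [simp]: "q o\<^sub>v = \<zero>"
  using q_tscale[of \<zero> "o\<^sub>v"] by simp

lemma q_tadd: "u \<in> V \<Longrightarrow> w \<in> V \<Longrightarrow> q (u \<boxplus> w) = q u \<oplus> q w \<oplus> B u w"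
proof -
  assume [simp]: "u \<in> V" "w \<in> V"
  have "q (u \<boxplus> w) \<in> carrier F" "q u \<in> carrier F" "q w \<in> carrier F" by simp_all
  then show "q (u \<boxplus> w) = q u \<oplus> q w \<oplus> B u w"
    unfolding polar_form_def by algebra
qed

text \<open>Grouped as a linear form in the first vector with coefficients depending only on the
  second, so that linearity on the left follows from distributivity. The doubled terms are the
  diagonal entries 2a, 2b, 2c of the Gram matrix.\<close>

lemma B_coords:
  assumes "(a, b, c, f, g, h) \<in> conic_coeffs F" "(x, y, z) \<in> V" "(x', y', z') \<in> V"
  shows "polar_form F (a, b, c, f, g, h) (x, y, z) (x', y', z') =
    x \<otimes> (a \<otimes> x' \<oplus> a \<otimes> x' \<oplus> h \<otimes> y' \<oplus> g \<otimes> z') \<oplus>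
    y \<otimes> (b \<otimes> y' \<oplus> b \<otimes> y' \<oplus> h \<otimes> x' \<oplus> f \<otimes> z') \<oplus>
    z \<otimes> (c \<otimes> z' \<oplus> c \<otimes> z' \<oplus> g \<otimes> x' \<oplus> f \<otimes> y')" (is "?l = ?r")
proof -
  let ?Q = "(a, b, c, f, g, h)"
  have "qform F ?Q ((x, y, z) \<boxplus> (x', y', z')) = ?r \<oplus> qform F ?Q (x', y', z') \<oplus> qform F ?Q (x, y, z)"
    using assms by (simp add: conic_coeffs_def triples_def l_distr r_distr m_ac a_ac)
  moreover have "?r \<in> carrier F" "qform F ?Q (x', y', z') \<in> carrier F" "qform F ?Q (x, y, z) \<in> carrier F"
    using assms by (simp_all add: conic_coeffs_def triples_def)
  ultimately show ?thesis
    unfolding polar_form_def by algebra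
qed

lemma B_sym: "u \<in> V \<Longrightarrow> w \<in> V \<Longrightarrow> B u w = B w u"
  by (simp add: polar_form_def tadd_comm a_ac minus_eq)

lemma B_tadd_left [simp]:
  assumes "u \<in> V" "w \<in> V" "y \<in> V"
  shows "B (u \<boxplus> w) y = B u y \<oplus> B w y"
proof -
  obtain a b c f g h where Q: "Q = (a, b, c, f, g, h)" by (cases Q)
  obtain y1 y2 y3 where y: "y = (y1, y2, y3)" by (cases y)
  obtain u1 u2 u3 where u: "u = (u1, u2, u3)" by (cases u)
  obtain w1 w2 w3 where w: "w = (w1, w2, w3)" by (cases w)
  have s: "(u1 \<oplus> w1, u2 \<oplus> w2, u3 \<oplus> w3) \<in> V"
    using tadd_closed[OF assms(1,2)] by (simp add: u w)
  have l: "(x1 \<oplus> x2) \<otimes> l1 \<oplus> (y1 \<oplus> y2) \<otimes> l2 \<oplus> (z1 \<oplus> z2) \<otimes> l3 =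
      (x1 \<otimes> l1 \<oplus> y1 \<otimes> l2 \<oplus> z1 \<otimes> l3) \<oplus> (x2 \<otimes> l1 \<oplus> y2 \<otimes> l2 \<oplus> z2 \<otimes> l3)"
    if "x1 \<in> carrier F" "x2 \<in> carrier F" "y1 \<in> carrier F" "y2 \<in> carrier F"
      "z1 \<in> carrier F" "z2 \<in> carrier F" "l1 \<in> carrier F" "l2 \<in> carrier F" "l3 \<in> carrier F"
    for x1 x2 y1 y2 z1 z2 l1 l2 l3
    using that by (simp add: l_distr a_ac)
  show ?thesis
    using coeffs_closed assms s
    unfolding Q y u w by (simp add: B_coords) (subst l; simp add: conic_coeffs_def triples_def)
qed

lemma B_tadd_right [simp]:
  "u \<in> V \<Longrightarrow> w \<in> V \<Longrightarrow> y \<in> V \<Longrightarrow> B y (u \<boxplus> w) = B y u \<oplus> B y w"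
  by (simp add: B_sym[of y])

lemma B_tscale_left [simp]:
  assumes "t \<in> carrier F" "u \<in> V" "y \<in> V"
  shows "B (t \<cdot> u) y = t \<otimes> B u y"
proof -
  obtain a b c f g h where Q: "Q = (a, b, c, f, g, h)" by (cases Q)
  obtain y1 y2 y3 where y: "y = (y1, y2, y3)" by (cases y)
  obtain u1 u2 u3 where u: "u = (u1, u2, u3)" by (cases u)
  have s: "(t \<otimes> u1, t \<otimes> u2, t \<otimes> u3) \<in> V"
    using tscale_closed[OF assms(1,2)] by (simp add: u)
  have l: "t \<otimes> x1 \<otimes> l1 \<oplus> t \<otimes> y1 \<otimes> l2 \<oplus> t \<otimes> z1 \<otimes> l3 = t \<otimes> (x1 \<otimes> l1 \<oplus> y1 \<otimes> l2 \<oplus> z1 \<otimes> l3)"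
    if "x1 \<in> carrier F" "y1 \<in> carrier F"
      "z1 \<in> carrier F" "l1 \<in> carrier F" "l2 \<in> carrier F" "l3 \<in> carrier F"
    for x1 y1 z1 l1 l2 l3
    using that assms(1) by (simp add: r_distr m_ac)
  show ?thesis
    using coeffs_closed assms s
    unfolding Q y u by (simp add: B_coords) (subst l; simp add: conic_coeffs_def triples_def)
qed

lemma B_tscale_right [simp]:
  "t \<in> carrier F \<Longrightarrow> u \<in> V \<Longrightarrow> y \<in> V \<Longrightarrow> B y (t \<cdot> u) = t \<otimes> B y u"
  by (simp add: B_sym[of y])

lemma B_tzero [simp]: "u \<in> V \<Longrightarrow> B u o\<^sub>v = \<zero>" "u \<in> V \<Longrightarrow> B o\<^sub>v u = \<zero>"
  using B_tscale_left[of \<zero> "o\<^sub>v" u] B_tscale_right[of \<zero> "o\<^sub>v" u] by simp_all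

lemma B_self: "u \<in> V \<Longrightarrow> B u u = (\<one> \<oplus> \<one>) \<otimes> q u"
proof -
  assume u: "u \<in> V"
  then have "u \<boxplus> u = (\<one> \<oplus> \<one>) \<cdot> u" by (simp add: tscale_add)
  then have "B u u = (\<one> \<oplus> \<one>) \<otimes> (\<one> \<oplus> \<one>) \<otimes> q u \<ominus> q u \<ominus> q u"
    unfolding polar_form_def using u by simp
  also have "\<dots> = (\<one> \<oplus> \<one>) \<otimes> q u"
    using q_closed[OF u] by algebra
  finally show ?thesis .
qed

lemma B_self_eq_zero: "u \<in> V \<Longrightarrow> B u u = \<zero> \<longleftrightarrow> q u = \<zero>"
  using two_nonzero by (simp add: B_self integral_iff)

lemma nonradical:
  assumes "u \<in> V" "u \<noteq> o\<^sub>v"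
  obtains w where "w \<in> V" "B u w = \<one>"
proof -
  obtain w where w: "w \<in> V" "B u w \<noteq> \<zero>"
    using nondegenerate assms unfolding nondegenerate_conic_def by blast
  then have "inv (B u w) \<cdot> w \<in> V" "B u (inv (B u w) \<cdot> w) = \<one>"
    using assms field_Units by simp_all
  then show ?thesis using that by blast
qed

section \<open>Polar lines and counting in place of dimension\<close>

text \<open>For nonzero \<open>u\<close> this is the polar line of the point spanned by
  \<open>u\<close>, with the zero vector included.\<close>

definition perp :: "'a triple \<Rightarrow> 'a triple set" where
  "perp u = {y \<in> V. B u y = \<zero>}"

lemma perp_iff [simp]: "y \<in> perp u \<longleftrightarrow> y \<in> V \<and> B u y = \<zero>"
  by (simp add: perp_def)

lemma finite_perp [simp]: "finite (perp u)"
  by (simp add: perp_def)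

text \<open>With \<open>B u w = \<one>\<close>, every vector is uniquely a multiple of
  \<open>w\<close> plus an element of \<open>perp u\<close>, so the size of \<open>perp u\<close>
  times that of the field is the size of the whole space.\<close>

lemma card_perp:
  assumes "u \<in> V" "u \<noteq> o\<^sub>v"
  shows "card (perp u) = card (carrier F) ^ 2"
proof -
  obtain w where w: "w \<in> V" "B u w = \<one>" using nonradical[OF assms] .
  have "bij_betw (\<lambda>(c, y). c \<cdot> w \<boxplus> y) (carrier F \<times> perp u) V"
  proof (rule bij_betwI[where g = "\<lambda>v. (B u v, v \<boxplus> (\<ominus> B u v) \<cdot> w)"])
    show "(case (case x of (c, y) \<Rightarrow> c \<cdot> w \<boxplus> y) of v \<Rightarrow> (B u v, v \<boxplus> (\<ominus> B u v) \<cdot> w)) = x"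
      if "x \<in> carrier F \<times> perp u" for x
      using that assms w by (cases x) (simp add: tadd_diff(3))
    show "(\<lambda>v. (B u v, v \<boxplus> (\<ominus> B u v) \<cdot> w)) \<in> V \<rightarrow> carrier F \<times> perp u"
      using assms w by (auto simp: r_neg)
  qed (use assms w in \<open>simp_all add: tadd_diff(1) Pi_iff split: prod.splits\<close>)
  then have "card (carrier F) * card (perp u) = card (carrier F) * card (carrier F) ^ 2"
    using bij_betw_same_card by (fastforce simp: card_cartesian_product card_triples power3_eq_cube power2_eq_square)
  moreover have "card (carrier F) > 0"
    using finite_carrier card_gt_0_iff by blast
  ultimately show ?thesis by simp
qed

lemma card_carrier_gt: "card (carrier F) > 1"
proof -
  have "card {\<zero>, \<one>} \<le> card (carrier F)"
    by (rule card_mono) (auto simp: finite_carrier)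
  then show ?thesis by simp
qed

text \<open>Pigeonhole: \<open>B w\<close> maps the larger set \<open>perp u\<close> into the field,
  and the difference of two vectors with equal image is the required one. Taking
  \<open>w = u\<close> merely yields a nonzero vector of \<open>perp u\<close>.\<close>

lemma common_perp:
  assumes "u \<in> V" "w \<in> V" "u \<noteq> o\<^sub>v"
  obtains y where "y \<in> V" "y \<noteq> o\<^sub>v" "B u y = \<zero>" "B w y = \<zero>"
proof -
  have "card (B w ` perp u) < card (perp u)"
  proof -
    have "card (B w ` perp u) \<le> card (carrier F)"
      using assms finite_carrier by (intro card_mono) auto
    also have "\<dots> < card (perp u)"
      using card_perp[OF assms(1,3)] card_carrier_gt by (simp add: power2_eq_square)
    finally show ?thesis .
  qed
  then obtain y y' where y: "y \<in> perp u" "y' \<in> perp u" "y \<noteq> y'" "B w y = B w y'"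
    using pigeonhole by (metis inj_on_def)
  let ?d = "y \<boxplus> (\<ominus> \<one>) \<cdot> y'"
  have "?d \<noteq> o\<^sub>v"
  proof
    assume "?d = o\<^sub>v"
    then have "\<one> \<cdot> y' \<boxplus> ?d = y'" using y by simp
    then show False using tadd_diff(1)[of \<one> y' y] y by simp
  qed
  moreover have "B u ?d = \<zero>" "B w ?d = \<zero>" using y assms by (auto simp: r_neg l_minus)
  ultimately show ?thesis using that[of ?d] y by simp
qed

definition span2 :: "'a triple \<Rightarrow> 'a triple \<Rightarrow> 'a triple set" where
  "span2 u w = {a \<cdot> u \<boxplus> b \<cdot> w | a b. a \<in> carrier F \<and> b \<in> carrier F}"

lemma card_span2:
  assumes "u \<in> V" "w \<in> V" "independent_pair F u w"
  shows "card (span2 u w) = card (carrier F) ^ 2"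
proof -
  have "inj_on (\<lambda>(a, b). a \<cdot> u \<boxplus> b \<cdot> w) (carrier F \<times> carrier F)"
  proof (clarsimp simp: inj_on_def)
    fix a b a' b'
    assume c [simp]: "a \<in> carrier F" "b \<in> carrier F" "a' \<in> carrier F" "b' \<in> carrier F"
      and eq: "a \<cdot> u \<boxplus> b \<cdot> w = a' \<cdot> u \<boxplus> b' \<cdot> w"
    have "(a \<oplus> \<ominus> a') \<cdot> u \<boxplus> (b \<oplus> \<ominus> b') \<cdot> w = (a \<cdot> u \<boxplus> b \<cdot> w) \<boxplus> (\<ominus> b') \<cdot> w \<boxplus> (\<ominus> a') \<cdot> u"
      using assms(1,2) by (cases u; cases w) (simp add: triples_def l_distr a_ac)
    also have "\<dots> = o\<^sub>v"
      unfolding eq using assms(1,2) tscale_add[of a' "\<ominus> a'" u]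
      by (simp add: tadd_diff(2) r_neg)
    finally have "a \<oplus> \<ominus> a' = \<zero>" "b \<oplus> \<ominus> b' = \<zero>"
      using assms(3) a_closed[OF c(1) a_inv_closed[OF c(3)]] a_closed[OF c(2) a_inv_closed[OF c(4)]]
      unfolding independent_pair_def by blast+
    then show "a = a' \<and> b = b'" by (metis c a_inv_closed minus_equality minus_minus a_comm)
  qed
  moreover have "span2 u w = (\<lambda>(a, b). a \<cdot> u \<boxplus> b \<cdot> w) ` (carrier F \<times> carrier F)"
    by (auto simp: span2_def)
  ultimately show ?thesis
    by (simp add: card_image card_cartesian_product power2_eq_square)
qed

lemma span2_eq_perp:
  assumes "p \<in> V" "p \<noteq> o\<^sub>v" "u \<in> perp p" "w \<in> perp p" "independent_pair F u w"
  shows "span2 u w = perp p"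
proof (rule card_subset_eq)
  show "span2 u w \<subseteq> perp p" using assms by (auto simp: span2_def)
  show "card (span2 u w) = card (perp p)"
    using assms card_span2 card_perp by simp
qed simp

lemma orthogonal_independent:
  assumes "u \<in> V" "w \<in> V" "B u w = \<zero>" "q u \<noteq> \<zero>" "q w \<noteq> \<zero>"
  shows "independent_pair F u w"
  unfolding independent_pair_def
proof (intro ballI impI)
  fix a b assume ab: "a \<in> carrier F" "b \<in> carrier F" "a \<cdot> u \<boxplus> b \<cdot> w = o\<^sub>v"
  have "B (a \<cdot> u \<boxplus> b \<cdot> w) u = \<zero>" "B (a \<cdot> u \<boxplus> b \<cdot> w) w = \<zero>"
    using ab assms by simp_all
  then have "a \<otimes> B u u = \<zero>" "b \<otimes> B w w = \<zero>"
    using ab(1,2) assms B_sym[of u w] by simp_all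
  then show "a = \<zero> \<and> b = \<zero>"
    using ab(1,2) assms B_self_eq_zero by (simp add: integral_iff)
qed

lemma perp_decomp:
  assumes "p \<in> V" "q p \<noteq> \<zero>" "w \<in> V"
  obtains t s where "t \<in> carrier F" "s \<in> perp p" "w = t \<cdot> p \<boxplus> s"
proof -
  have n: "B p p \<noteq> \<zero>" using assms B_self_eq_zero by simp
  let ?t = "B p w \<otimes> inv (B p p)"
  have t: "?t \<in> carrier F" "?t \<otimes> B p p = B p w"
    using assms n field_Units by (simp_all add: m_assoc)
  have "w \<boxplus> (\<ominus> ?t) \<cdot> p \<in> perp p"
    using assms t by (simp add: l_minus r_neg)
  then show ?thesis using that[OF t(1)] tadd_diff(1)[OF t(1) assms(1,3)] by metis
qed

section \<open>Internal points and external lines\<close>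

text \<open>The vectors spanning poles of external lines: the form is anisotropic on
  \<open>perp p\<close>. Working with vectors instead of points means that each pole is counted once
  for every nonzero scalar.\<close>

definition internal :: "'a triple \<Rightarrow> bool" where
  "internal p \<longleftrightarrow> p \<in> V \<and> p \<noteq> o\<^sub>v \<and> (\<forall>y\<in>perp p. q y = \<zero> \<longrightarrow> y = o\<^sub>v)"

lemma internalD:
  assumes "internal p"
  shows "p \<in> V" "p \<noteq> o\<^sub>v" "\<And>y. y \<in> perp p \<Longrightarrow> y \<noteq> o\<^sub>v \<Longrightarrow> q y \<noteq> \<zero>"
  using assms unfolding internal_def by blast+

lemma internal_nonisotropic:
  assumes "internal p"
  shows "q p \<noteq> \<zero>"
  using internalD[OF assms] B_self_eq_zero[of p] by fastforce

lemma q_orthogonal: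
  assumes "a \<in> carrier F" "b \<in> carrier F" "u \<in> V" "w \<in> V" "B u w = \<zero>"
  shows "q (a \<cdot> u \<boxplus> b \<cdot> w) = a \<otimes> a \<otimes> q u \<oplus> b \<otimes> b \<otimes> q w"
  using assms by (simp add: q_tadd)

text \<open>An isotropic vector with coefficients a, b forces b to be nonzero and makes
  \<open>q u \<otimes> q w\<close> equal to minus a square, which is a square because -1 is one.
  This is where the root \<open>i\<close> of -1 enters.\<close>

lemma anisotropic_iff:
  assumes u: "u \<in> V" and w: "w \<in> V" and uw: "B u w = \<zero>" "q u \<noteq> \<zero>" "q w \<noteq> \<zero>"
  shows "(\<forall>y\<in>span2 u w. q y = \<zero> \<longrightarrow> y = o\<^sub>v) \<longleftrightarrow> \<not> is_square (q u \<otimes> q w)"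
proof -
  obtain i where i: "i \<in> carrier F" "i \<otimes> i = \<ominus> \<one>" using minus_one_square by blast
  have i0: "i \<noteq> \<zero>"
  proof
    assume "i = \<zero>"
    then have "\<ominus> (\<ominus> \<one>) = \<ominus> \<zero>" using i(2) by simp
    then show False by simp
  qed
  have quw: "q u \<in> carrier F" "q w \<in> carrier F" using u w by simp_all
  have ind: "independent_pair F u w" using orthogonal_independent assms by blast
  have "is_square (q u \<otimes> q w)" if y: "y \<in> span2 u w" "q y = \<zero>" "y \<noteq> o\<^sub>v" for y
  proof -
    obtain a b where ab: "a \<in> carrier F" "b \<in> carrier F" "y = a \<cdot> u \<boxplus> b \<cdot> w"
      using y by (auto simp: span2_def)
    have eq: "a \<otimes> a \<otimes> q u \<oplus> b \<otimes> b \<otimes> q w = \<zero>" using q_orthogonal[OF ab(1,2) u w uw(1)] y(2) ab(3) by simp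
    have b0: "b \<noteq> \<zero>"
    proof
      assume "b = \<zero>"
      then have "a = \<zero>" using eq ab quw uw by (simp add: integral_iff)
      then show False using \<open>b = \<zero>\<close> y ab u w by simp
    qed
    have "b \<otimes> b \<otimes> (q u \<otimes> q w) = (a \<otimes> a \<otimes> q u \<oplus> b \<otimes> b \<otimes> q w) \<otimes> q u \<oplus> \<ominus> \<one> \<otimes> (a \<otimes> q u) \<otimes> (a \<otimes> q u)"
      using ab(1,2) quw by algebra
    also have "\<dots> = (i \<otimes> (a \<otimes> q u)) \<otimes> (i \<otimes> (a \<otimes> q u))"
      unfolding eq i(2)[symmetric] using ab(1,2) quw i(1) by algebra
    finally have "is_square (b \<otimes> b \<otimes> (q u \<otimes> q w))"
      using ab quw i(1) unfolding is_square_def by blast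
    moreover have "is_square (b \<otimes> b)" using ab by (auto simp: is_square_def)
    ultimately show ?thesis
      using is_square_cancel[of "b \<otimes> b"] b0 ab quw by (simp add: integral_iff)
  qed
  moreover have "\<exists>y\<in>span2 u w. q y = \<zero> \<and> y \<noteq> o\<^sub>v" if sq: "is_square (q u \<otimes> q w)"
  proof -
    obtain z where z: "z \<in> carrier F" "q u \<otimes> q w = z \<otimes> z" using sq by (auto simp: is_square_def)
    have iq: "i \<otimes> q u \<in> carrier F" "i \<otimes> q u \<noteq> \<zero>"
      using i quw uw i0 by (simp_all add: integral_iff)
    \<comment> \<open>Its value is z^2 q(u) + i^2 q(u)^2 q(w), and both z^2 = q(u) q(w) and i^2 = -1
      make the terms cancel.\<close>
    let ?y = "z \<cdot> u \<boxplus> (i \<otimes> q u) \<cdot> w"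
    have "q ?y = (z \<otimes> z) \<otimes> q u \<oplus> (i \<otimes> i) \<otimes> q u \<otimes> q u \<otimes> q w"
      using q_orthogonal[OF z(1) iq(1) u w uw(1)] quw i(1) by (simp add: m_ac)
    also have "\<dots> = \<zero>" unfolding z(2)[symmetric] i(2) using quw by algebra
    finally have "q ?y = \<zero>" .
    moreover have "?y \<noteq> o\<^sub>v"
      using ind z(1) iq unfolding independent_pair_def by blast
    moreover have "?y \<in> span2 u w" using z iq by (auto simp: span2_def)
    ultimately show ?thesis by blast
  qed
  ultimately show ?thesis by blast
qed

lemma internal_iff:
  assumes "p \<in> V" "p \<noteq> o\<^sub>v" "u \<in> V" "w \<in> V" "B p u = \<zero>" "B p w = \<zero>"
    "B u w = \<zero>" "q u \<noteq> \<zero>" "q w \<noteq> \<zero>"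
  shows "internal p \<longleftrightarrow> \<not> is_square (q u \<otimes> q w)"
proof -
  have "span2 u w = perp p"
    using assms orthogonal_independent[of u w] by (intro span2_eq_perp) simp_all
  then show ?thesis
    using anisotropic_iff[of u w] assms by (simp add: internal_def)
qed

text \<open>In the orthogonal triple \<open>p\<close>, \<open>r\<close>, \<open>s\<close>, a vector
  is internal iff the product of the other two values is a nonsquare. The products deciding about
  \<open>r\<close> and \<open>s\<close> multiply to a square times \<open>q r \<otimes> q s\<close>,
  a nonsquare because \<open>p\<close> is internal; so exactly one of them is a square.\<close>

lemma internal_dichotomy:
  assumes p: "internal p" and r: "r \<in> perp p" "r \<noteq> o\<^sub>v" and s: "s \<in> perp p" "s \<noteq> o\<^sub>v"
    and rs: "B r s = \<zero>"
  shows "internal r \<longleftrightarrow> \<not> internal s"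
proof -
  note pD = internalD[OF p]
  have V: "p \<in> V" "r \<in> V" "s \<in> V" using pD r s by simp_all
  have nz: "q p \<noteq> \<zero>" "q r \<noteq> \<zero>" "q s \<noteq> \<zero>"
    using pD(3) r s internal_nonisotropic[OF p] by blast+
  have orth: "B p r = \<zero>" "B r p = \<zero>" "B p s = \<zero>" "B s p = \<zero>" "B s r = \<zero>"
    using r s rs V B_sym by auto
  have c: "q p \<in> carrier F" "q r \<in> carrier F" "q s \<in> carrier F" using V by simp_all
  have P: "\<not> is_square (q r \<otimes> q s)"
    using internal_iff[of p r s] p pD V orth rs nz by simp
  have R: "internal r \<longleftrightarrow> \<not> is_square (q p \<otimes> q s)"
    using internal_iff[of r p s] r V orth rs nz by simp
  have S: "internal s \<longleftrightarrow> \<not> is_square (q p \<otimes> q r)"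
    using internal_iff[of s p r] s V orth rs nz by simp
  have pp: "is_square (q p \<otimes> q p)" "q p \<otimes> q p \<noteq> \<zero>"
    using c nz by (auto simp: is_square_def integral_iff)
  have e: "(q p \<otimes> q r) \<otimes> (q p \<otimes> q s) = (q p \<otimes> q p) \<otimes> (q r \<otimes> q s)"
    using c by (simp add: m_ac)
  have "\<not> is_square ((q p \<otimes> q r) \<otimes> (q p \<otimes> q s))"
    unfolding e using is_square_cancel[OF pp] P c by blast
  then show ?thesis
    unfolding R S using is_square_mult is_square_mult_nonsquares c m_closed by metis
qed

section \<open>Existence of internal points\<close>

text \<open>Choose \<open>z\<close> in the plane with \<open>B y z = \<one>\<close>. Adding
  \<open>m\<close> times the isotropic \<open>y\<close> to \<open>z\<close> shifts the value by
  exactly \<open>m\<close>, so every value is reached.\<close>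

lemma hyperbolic_represents:
  assumes e: "e \<in> V" "q e \<noteq> \<zero>" and y: "y \<in> perp e" "y \<noteq> o\<^sub>v" "q y = \<zero>" and c: "c \<in> carrier F"
  obtains u where "u \<in> perp e" "q u = c"
proof -
  have yV: "y \<in> V" and ey: "B e y = \<zero>" "B y e = \<zero>" using y e B_sym by auto
  obtain w where w: "w \<in> V" "B y w = \<one>" using nonradical[OF yV y(2)] .
  obtain t z where z: "t \<in> carrier F" "z \<in> perp e" "w = t \<cdot> e \<boxplus> z"
    using perp_decomp[OF e w(1)] .
  have Byz: "B y z = \<one>" "B z y = \<one>" using w z yV e ey B_sym[of y z] by simp_all
  let ?m = "c \<ominus> q z"
  have zV: "z \<in> V" using z by simp
  have m: "?m \<in> carrier F" using c zV by simp
  have "q (?m \<cdot> y \<boxplus> z) = q z \<oplus> ?m"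
    using m yV zV y Byz by (simp add: q_tadd)
  also have "\<dots> = c" using c q_closed[OF zV] by algebra
  finally have "q (?m \<cdot> y \<boxplus> z) = c" .
  moreover have "?m \<cdot> y \<boxplus> z \<in> perp e"
    using m yV z e ey by simp
  ultimately show ?thesis using that by blast
qed

text \<open>If two vectors with \<open>B\<close> equal to 1 are both isotropic, their sum has value
  1.\<close>

lemma nonisotropic_exists:
  obtains e where "e \<in> V" "q e \<noteq> \<zero>"
proof -
  have "(\<one>, \<zero>, \<zero>) \<in> V" "(\<one>, \<zero>, \<zero>) \<noteq> o\<^sub>v" by (auto simp: triples_def tzero_def)
  then obtain w where w: "w \<in> V" "B (\<one>, \<zero>, \<zero>) w = \<one>" using nonradical by blast
  have "q ((\<one>, \<zero>, \<zero>) \<boxplus> w) = q (\<one>, \<zero>, \<zero>) \<oplus> q w \<oplus> \<one>"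
    using q_tadd[OF \<open>(\<one>, \<zero>, \<zero>) \<in> V\<close> w(1)] w(2) by simp
  then have "q ((\<one>, \<zero>, \<zero>) \<boxplus> w) \<noteq> \<zero> \<or> q (\<one>, \<zero>, \<zero>) \<noteq> \<zero> \<or> q w \<noteq> \<zero>"
    by force
  then show ?thesis using that w(1) \<open>(\<one>, \<zero>, \<zero>) \<in> V\<close> tadd_closed by blast
qed

text \<open>If a nonisotropic \<open>e\<close> is not internal, its polar line takes every value, in
  particular \<open>q e\<close> times a nonsquare, at some \<open>u\<close>. Then
  \<open>q e \<otimes> q u\<close> is a nonsquare and a vector orthogonal to both \<open>e\<close>
  and \<open>u\<close> is internal.\<close>

lemma internal_exists: "\<exists>p. internal p"
proof -
  obtain e where e: "e \<in> V" "q e \<noteq> \<zero>" using nonisotropic_exists .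
  have e0: "e \<noteq> o\<^sub>v" using e by auto
  show ?thesis
  proof (cases "internal e")
    case False
    then obtain y where y: "y \<in> perp e" "q y = \<zero>" "y \<noteq> o\<^sub>v"
      using e e0 by (auto simp: internal_def)
    obtain n where n: "n \<in> carrier F" "\<not> is_square n" using nonsquare_exists .
    have n0: "n \<noteq> \<zero>" using n(2) by (force simp: is_square_def)
    have qe: "q e \<in> carrier F" using e by simp
    obtain u where u: "u \<in> perp e" "q u = q e \<otimes> n"
      using hyperbolic_represents[OF e y(1,3,2), of "q e \<otimes> n"] qe n by auto
    obtain p where p: "p \<in> V" "p \<noteq> o\<^sub>v" "B e p = \<zero>" "B u p = \<zero>"
      using common_perp[of e u] e e0 u by auto
    have "\<not> is_square (q e \<otimes> q u)"
    proof
      assume "is_square (q e \<otimes> q u)"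
      then have "is_square ((q e \<otimes> q e) \<otimes> n)" using u(2) qe n by (simp add: m_assoc)
      moreover have "is_square (q e \<otimes> q e)" using qe by (auto simp: is_square_def)
      ultimately show False
        using is_square_cancel[of "q e \<otimes> q e" n] qe n e by (simp add: integral_iff)
    qed
    then have "internal p"
      using internal_iff[of p e u] p e u qe n n0 B_sym[of p] by (simp add: integral_iff)
    then show ?thesis ..
  qed blast
qed

section \<open>External lines and their poles\<close>

lemma internal_tscale:
  assumes "internal p" "t \<in> carrier F" "t \<noteq> \<zero>"
  shows "internal (t \<cdot> p)" "perp (t \<cdot> p) = perp p"
proof -
  show *: "perp (t \<cdot> p) = perp p"
    using assms internalD(1)[OF assms(1)] by (auto simp: perp_def integral_iff)
  show "internal (t \<cdot> p)"
    using assms unfolding internal_def * by (simp add: tscale_eq_tzero)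
qed

text \<open>Split \<open>w\<close> along \<open>p\<close>: the component \<open>s\<close> in
  \<open>perp p\<close> is orthogonal to \<open>w\<close> and to \<open>p\<close>, hence to itself,
  and vanishes by anisotropy.\<close>

lemma polarity_perp:
  assumes p: "internal p"
  shows "polarity F Q (perp p) = {t \<cdot> p | t. t \<in> carrier F}"
proof
  note pD = internalD[OF p]
  show "{t \<cdot> p | t. t \<in> carrier F} \<subseteq> polarity F Q (perp p)"
    using pD(1) by (auto simp: polarity_def B_sym[of _ p])
  show "polarity F Q (perp p) \<subseteq> {t \<cdot> p | t. t \<in> carrier F}"
  proof
    fix w assume w: "w \<in> polarity F Q (perp p)"
    then have wV: "w \<in> V" by (simp add: polarity_def)
    obtain t s where ts: "t \<in> carrier F" "s \<in> perp p" "w = t \<cdot> p \<boxplus> s"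
      using perp_decomp[OF pD(1) internal_nonisotropic[OF p] wV] .
    have "B s w = \<zero>" using w ts(2) unfolding polarity_def by blast
    then have "B s s = \<zero>" using ts pD(1) B_sym[of s p] by simp
    then have "s = o\<^sub>v" using pD(3)[OF ts(2)] ts(2) B_self_eq_zero[of s] by auto
    then show "w \<in> {t \<cdot> p | t. t \<in> carrier F}" using ts pD(1) by auto
  qed
qed

text \<open>The polarity recovers the pole from the line, so internal vectors with the same polar
  line are proportional.\<close>

lemma perp_eq_iff:
  assumes "internal p" "internal r"
  shows "perp r = perp p \<longleftrightarrow> (\<exists>t\<in>carrier F - {\<zero>}. r = t \<cdot> p)"
proof
  assume "perp r = perp p"
  then have "polarity F Q (perp r) = polarity F Q (perp p)" by simp
  moreover have "r \<in> polarity F Q (perp r)"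
    unfolding polarity_perp[OF assms(2)]
    using internalD(1)[OF assms(2)] tscale_simps(2)[of r] one_closed by (smt (verit) mem_Collect_eq)
  ultimately obtain t where "t \<in> carrier F" "r = t \<cdot> p"
    using polarity_perp[OF assms(1)] by auto
  then show "\<exists>t\<in>carrier F - {\<zero>}. r = t \<cdot> p"
    using internalD(2)[OF assms(2)] internalD(1)[OF assms(1)] by auto
qed (use internal_tscale[OF assms(1)] in auto)

text \<open>Adjacency becomes orthogonality of poles. The lines differ because \<open>r\<close> lies
  in \<open>perp p\<close> but, being nonisotropic, not in \<open>perp r\<close>.\<close>

lemma polar_conjugate_perp:
  assumes "internal p" "internal r"
  shows "polar_conjugate F Q (perp p) (perp r) \<longleftrightarrow> B p r = \<zero>"
proof
  note D = internalD(1)[OF assms(1)] internalD(1)[OF assms(2)]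
  assume "polar_conjugate F Q (perp p) (perp r)"
  then have "polarity F Q (perp p) \<subseteq> perp r" by (simp add: polar_conjugate_def)
  then have "\<one> \<cdot> p \<in> perp r" unfolding polarity_perp[OF assms(1)] by blast
  then show "B p r = \<zero>" using D B_sym by simp
next
  note D = internalD(1)[OF assms(1)] internalD(1)[OF assms(2)]
  assume pr: "B p r = \<zero>"
  then have "r \<in> perp p" using D by simp
  moreover have "r \<notin> perp r"
    using internal_nonisotropic[OF assms(2)] B_self_eq_zero D by simp
  ultimately have "perp p \<noteq> perp r" by blast
  moreover have "polarity F Q (perp p) \<subseteq> perp r"
    unfolding polarity_perp[OF assms(1)] using pr D B_sym[of r p] by auto
  ultimately show "polar_conjugate F Q (perp p) (perp r)" by (simp add: polar_conjugate_def)
qed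

lemma external_lines_eq: "external_lines F Q = perp ` {p. internal p}"
proof
  show "external_lines F Q \<subseteq> perp ` {p. internal p}"
  proof
    fix l assume l: "l \<in> external_lines F Q"
    then obtain u w where uw: "u \<in> V" "w \<in> V" "independent_pair F u w" "l = span2 u w"
      by (auto simp: external_lines_def pg_lines_def span2_def)
    have "u \<noteq> o\<^sub>v"
    proof
      assume "u = o\<^sub>v"
      then have "\<one> \<cdot> u \<boxplus> \<zero> \<cdot> w = o\<^sub>v" using uw by simp
      then show False using uw(3) unfolding independent_pair_def by (metis one_closed zero_closed one_not_zero)
    qed
    then obtain p where p: "p \<in> V" "p \<noteq> o\<^sub>v" "B u p = \<zero>" "B w p = \<zero>"
      using common_perp[of u w] uw by blast
    have lp: "l = perp p"
      using span2_eq_perp[of p u w] uw p B_sym[of p] by simp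
    have "y = o\<^sub>v" if y: "y \<in> perp p" "q y = \<zero>" for y
    proof (rule ccontr)
      assume n: "y \<noteq> o\<^sub>v"
      let ?P = "{a \<cdot> y | a. a \<in> carrier F}"
      have "?P \<in> conic_points F Q"
        using y n unfolding conic_points_def pg_points_def by fastforce
      moreover have "?P \<subseteq> l" using y p unfolding lp by auto
      ultimately show False using l by (auto simp: external_lines_def)
    qed
    then show "l \<in> perp ` {p. internal p}" using p lp by (auto simp: internal_def)
  qed
  show "perp ` {p. internal p} \<subseteq> external_lines F Q"
  proof clarify
    fix p assume p: "internal p"
    note pD = internalD[OF p]
    \<comment> \<open>An orthogonal basis of \<open>perp p\<close>; anisotropy makes both vectors
      nonisotropic and therefore independent.\<close>
    obtain e1 where e1: "e1 \<in> V" "e1 \<noteq> o\<^sub>v" "B p e1 = \<zero>"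
      using common_perp[of p p] pD by blast
    obtain e2 where e2: "e2 \<in> V" "e2 \<noteq> o\<^sub>v" "B p e2 = \<zero>" "B e1 e2 = \<zero>"
      using common_perp[of p e1] pD e1 by blast
    have ind: "independent_pair F e1 e2"
      using orthogonal_independent[of e1 e2] pD(3) e1 e2 by simp
    have "span2 e1 e2 = perp p"
      using span2_eq_perp[of p e1 e2] pD e1 e2 ind by simp
    then have "perp p \<in> pg_lines F"
      using ind e1 e2 unfolding pg_lines_def span2_def by blast
    moreover have "\<not> P \<subseteq> perp p" if P: "P \<in> conic_points F Q" for P
    proof
      assume sub: "P \<subseteq> perp p"
      obtain u where u: "u \<in> V" "u \<noteq> o\<^sub>v" "P = {a \<cdot> u | a. a \<in> carrier F}"
        using P by (auto simp: conic_points_def pg_points_def)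
      then have "\<one> \<cdot> u \<in> P" by blast
      then have "u \<in> P" using u by simp
      then have "q u = \<zero>" "u \<in> perp p" using P sub by (auto simp: conic_points_def)
      then show False using pD(3) u by blast
    qed
    ultimately show "perp p \<in> external_lines F Q" by (auto simp: external_lines_def)
  qed
qed

section \<open>Counting in the polarity graph\<close>

lemma tscale_add_pair:
  assumes "a \<in> carrier F" "a' \<in> carrier F" "b \<in> carrier F" "b' \<in> carrier F" "u \<in> V" "w \<in> V"
  shows "(a \<oplus> a') \<cdot> u \<boxplus> (b \<oplus> b') \<cdot> w = (a \<cdot> u \<boxplus> b \<cdot> w) \<boxplus> (a' \<cdot> u \<boxplus> b' \<cdot> w)"
  using assms by (cases u; cases w) (simp add: triples_def l_distr a_ac)

lemma tscale_inj:
  assumes "p \<in> V" "p \<noteq> o\<^sub>v" "t \<in> carrier F" "s \<in> carrier F" "t \<cdot> p = s \<cdot> p"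
  shows "t = s"
proof -
  obtain w where w: "w \<in> V" "B p w = \<one>" using nonradical[OF assms(1,2)] .
  have "t \<otimes> B p w = s \<otimes> B p w"
    using B_tscale_left[OF assms(3,1) w(1)] B_tscale_left[OF assms(4,1) w(1)] assms(5) by metis
  then show ?thesis using assms w by simp
qed

text \<open>Converts counts of vectors into counts of lines: each line in the image is the polar of
  all nonzero multiples of one vector, and \<open>S\<close> contains all of them.\<close>

lemma card_internal_cone:
  assumes S: "\<And>p. p \<in> S \<Longrightarrow> internal p"
    and scale: "\<And>p t. p \<in> S \<Longrightarrow> t \<in> carrier F - {\<zero>} \<Longrightarrow> t \<cdot> p \<in> S"
  shows "card S = (card (carrier F) - 1) * card (perp ` S)"
proof -
  have fin: "finite S"
    using S internalD(1) finite_subset[OF _ finite_triples, of S] by blast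
  have fibre: "card {r \<in> S. perp r = l} = card (carrier F) - 1" if l: "l \<in> perp ` S" for l
  proof -
    obtain p where p: "p \<in> S" "l = perp p" using l by blast
    have "{r \<in> S. perp r = l} = (\<lambda>t. t \<cdot> p) ` (carrier F - {\<zero>})"
      using p S scale perp_eq_iff[of p] by blast
    moreover have "inj_on (\<lambda>t. t \<cdot> p) (carrier F - {\<zero>})"
      using tscale_inj[of p] internalD[OF S[OF p(1)]] by (auto simp: inj_on_def)
    ultimately show ?thesis using finite_carrier by (simp add: card_image)
  qed
  have "card S = (\<Sum>l\<in>perp ` S. card {r \<in> S. perp r = l})"
    using sum.image_gen[OF fin, of "\<lambda>_. 1 :: nat" perp] by simp
  then show ?thesis using fibre by simp
qed

text \<open>The map \<open>f\<close> sends a point of the external line to its conjugate on that line, and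
  exactly one of the two is internal.\<close>

lemma card_internal_perp:
  assumes p: "internal p"
  shows "2 * card {r. internal r \<and> B p r = \<zero>} = card (carrier F) ^ 2 - 1"
proof -
  note pD = internalD[OF p]
  obtain e where e: "e \<in> V" "e \<noteq> o\<^sub>v" "B p e = \<zero>"
    using common_perp[of p p] pD by blast
  obtain e' where e': "e' \<in> V" "e' \<noteq> o\<^sub>v" "B p e' = \<zero>" "B e e' = \<zero>"
    using common_perp[of p e] pD e by blast
  have ind: "independent_pair F e e'"
    using orthogonal_independent[of e e'] pD(3) e e' by simp
  have span: "span2 e e' = perp p"
    using span2_eq_perp[of p e e'] pD e e' ind by simp
  have nondeg: "d = o\<^sub>v" if d: "d \<in> perp p" "B d e = \<zero>" "B d e' = \<zero>" for d
  proof (rule ccontr)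
    assume n: "d \<noteq> o\<^sub>v"
    obtain a b where ab: "a \<in> carrier F" "b \<in> carrier F" "d = a \<cdot> e \<boxplus> b \<cdot> e'"
      using d(1) unfolding span[symmetric] by (auto simp: span2_def)
    have dV: "d \<in> V" using d by simp
    have "B d (a \<cdot> e \<boxplus> b \<cdot> e') = \<zero>" using ab(1,2) d dV e e' by simp
    then have "B d d = \<zero>" unfolding ab(3)[symmetric] .
    then show False using pD(3)[OF d(1) n] B_self_eq_zero[OF dV] by simp
  qed
  \<comment> \<open>A quarter turn of the line: the coefficients are swapped with one sign so that
    the two terms of \<open>B r (f r)\<close> cancel.\<close>
  define f where "f r = (\<ominus> B r e') \<cdot> e \<boxplus> B r e \<cdot> e'" for r
  define I where "I = {r \<in> perp p. r \<noteq> o\<^sub>v \<and> internal r}"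
  define J where "J = {r \<in> perp p. r \<noteq> o\<^sub>v \<and> \<not> internal r}"
  have fperp: "f r \<in> perp p" "B r (f r) = \<zero>" if "r \<in> perp p" for r
  proof -
    have c: "r \<in> V" "B r e \<in> carrier F" "B r e' \<in> carrier F" using that e e' by simp_all
    show "f r \<in> perp p" using c e e' pD by (simp add: f_def)
    have "B r (f r) = (\<ominus> B r e') \<otimes> B r e \<oplus> B r e \<otimes> B r e'"
      using c(1) e e' by (simp add: f_def)
    also have "\<dots> = \<zero>" using c(2,3) by algebra
    finally show "B r (f r) = \<zero>" .
  qed
  have fnz: "f r \<noteq> o\<^sub>v" if r: "r \<in> perp p" "r \<noteq> o\<^sub>v" for r
  proof
    assume 0: "f r = o\<^sub>v"
    have c: "r \<in> V" "B r e \<in> carrier F" "\<ominus> B r e' \<in> carrier F" using r e e' by simp_all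
    then have "\<ominus> B r e' = \<zero>" "B r e = \<zero>"
      using ind 0 unfolding independent_pair_def f_def by blast+
    moreover have "B r e' \<in> carrier F" using c e' by simp
    ultimately have "B r e' = \<zero>" using minus_minus[of "B r e'"] by simp
    then show False using nondeg[OF r(1)] \<open>B r e = \<zero>\<close> r(2) by blast
  qed
  \<comment> \<open>Compatibility with differences reduces injectivity to the trivial kernel given
    by \<open>fnz\<close>.\<close>
  have fadd: "f (r \<boxplus> (\<ominus> \<one>) \<cdot> s) = f r \<boxplus> (\<ominus> \<one>) \<cdot> f s" if "r \<in> perp p" "s \<in> perp p" for r s
  proof -
    have V: "r \<in> V" "s \<in> V" using that by simp_all
    have c: "B r e \<in> carrier F" "B r e' \<in> carrier F" "B s e \<in> carrier F" "B s e' \<in> carrier F"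
      using V e e' by simp_all
    let ?m = "\<ominus> \<one>"
    have m: "?m \<in> carrier F" by simp
    have n: "\<ominus> B r e' \<in> carrier F" "\<ominus> B s e' \<in> carrier F" using c by simp_all
    have "\<ominus> (B r e' \<oplus> ?m \<otimes> B s e') = \<ominus> B r e' \<oplus> ?m \<otimes> (\<ominus> B s e')"
      using c by algebra
    moreover have "B (r \<boxplus> ?m \<cdot> s) x = B r x \<oplus> ?m \<otimes> B s x" if "x \<in> V" for x
      using B_tadd_left[OF V(1) tscale_closed[OF m V(2)] that] B_tscale_left[OF m V(2) that] by metis
    ultimately have "f (r \<boxplus> ?m \<cdot> s)
        = (\<ominus> B r e' \<oplus> ?m \<otimes> (\<ominus> B s e')) \<cdot> e \<boxplus> (B r e \<oplus> ?m \<otimes> B s e) \<cdot> e'"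
      unfolding f_def using e(1) e'(1) by metis
    also have "\<dots> = f r \<boxplus> ((?m \<otimes> (\<ominus> B s e')) \<cdot> e \<boxplus> (?m \<otimes> B s e) \<cdot> e')"
      unfolding f_def
      by (rule tscale_add_pair[OF n(1) m_closed[OF m n(2)] c(1) m_closed[OF m c(3)] e(1) e'(1)])
    also have "(?m \<otimes> (\<ominus> B s e')) \<cdot> e \<boxplus> (?m \<otimes> B s e) \<cdot> e' = ?m \<cdot> f s"
      unfolding f_def tscale_tadd[OF m tscale_closed[OF n(2) e(1)] tscale_closed[OF c(3) e'(1)]]
        tscale_tscale[OF m n(2) e(1)] tscale_tscale[OF m c(3) e'(1)] ..
    finally show ?thesis .
  qed
  have finj: "inj_on f (perp p)"
  proof (rule inj_onI)
    fix r s assume rs: "r \<in> perp p" "s \<in> perp p" "f r = f s"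
    have sV: "s \<in> V" "r \<in> V" "f s \<in> V" using rs fperp(1)[OF rs(2)] by simp_all
    have "f s \<boxplus> (\<ominus> \<one>) \<cdot> f s = o\<^sub>v"
      using tadd_diff(3)[of \<one> "f s" "o\<^sub>v"] sV by simp
    then have "f (r \<boxplus> (\<ominus> \<one>) \<cdot> s) = o\<^sub>v" using fadd[OF rs(1,2)] rs(3) by simp
    moreover have "r \<boxplus> (\<ominus> \<one>) \<cdot> s \<in> perp p" using rs pD(1) by (simp add: l_minus)
    ultimately have "r \<boxplus> (\<ominus> \<one>) \<cdot> s = o\<^sub>v" using fnz by blast
    then show "r = s" using tadd_diff(1)[of \<one> s r] sV by simp
  qed
  have fin: "finite I" "finite J" by (simp_all add: I_def J_def)
  have swap: "internal r \<longleftrightarrow> \<not> internal (f r)" if "r \<in> perp p" "r \<noteq> o\<^sub>v" for r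
    using internal_dichotomy[OF p that fperp(1)[OF that(1)] fnz[OF that] fperp(2)[OF that(1)]] .
  have "f ` I \<subseteq> J"
  proof (rule image_subsetI)
    fix r assume "r \<in> I"
    then have r: "r \<in> perp p" "r \<noteq> o\<^sub>v" "internal r" by (simp_all add: I_def)
    show "f r \<in> J" using fperp(1)[OF r(1)] fnz[OF r(1,2)] swap[OF r(1,2)] r(3) by (simp add: J_def)
  qed
  moreover have "f ` J \<subseteq> I"
  proof (rule image_subsetI)
    fix r assume "r \<in> J"
    then have r: "r \<in> perp p" "r \<noteq> o\<^sub>v" "\<not> internal r" by (simp_all add: J_def)
    show "f r \<in> I" using fperp(1)[OF r(1)] fnz[OF r(1,2)] swap[OF r(1,2)] r(3) by (simp add: I_def)
  qed
  moreover have "I \<subseteq> perp p" "J \<subseteq> perp p" unfolding I_def J_def by blast+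
  then have "inj_on f I" "inj_on f J" using inj_on_subset[OF finj] by blast+
  \<comment> \<open>Injections in both directions between finite sets.\<close>
  ultimately have "card I = card J"
    using card_inj_on_le fin by (metis le_antisym)
  moreover have "card I + card J = card (perp p - {o\<^sub>v})"
  proof -
    have "I \<inter> J = {}" "I \<union> J = perp p - {o\<^sub>v}" unfolding I_def J_def by blast+
    then show ?thesis using fin card_Un_disjoint[of I J] by simp
  qed
  moreover have "card (perp p - {o\<^sub>v}) = card (carrier F) ^ 2 - 1"
    using pD by (simp add: card_perp)
  moreover have "{r. internal r \<and> B p r = \<zero>} = I"
    unfolding I_def internal_def perp_iff by blast
  ultimately show ?thesis by simp
qed

section \<open>Bounding the number of internal vectors\<close>

text \<open>All internal values lie in one square class. With \<open>w\<close> orthogonal to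
  \<open>p\<close> and \<open>u\<close>, the polar lines of \<open>p\<close> and \<open>u\<close>
  have orthogonal bases \<open>w\<close>, \<open>s\<close> and \<open>w\<close>, \<open>?s\<close>.
  Both products of values are nonsquares, and together they give a square times
  \<open>q p \<otimes> q u\<close>.\<close>

lemma internal_product_square:
  assumes p: "internal p" and u: "internal u" and ts: "t \<in> carrier F" "s \<in> perp p" "s \<noteq> o\<^sub>v"
    and eq: "u = t \<cdot> p \<boxplus> s"
  shows "is_square (q p \<otimes> q u)"
proof -
  note pD = internalD[OF p]
  note uD = internalD[OF u]
  have V: "s \<in> V" "B p s = \<zero>" "B s p = \<zero>" using ts pD(1) B_sym[of s p] by simp_all
  obtain w where w: "w \<in> V" "w \<noteq> o\<^sub>v" "B p w = \<zero>" "B s w = \<zero>"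
    using common_perp[of p s] pD V by blast
  have wp: "B w p = \<zero>" "B w s = \<zero>" using w pD V B_sym[of w] by simp_all
  have nz: "q p \<noteq> \<zero>" "q u \<noteq> \<zero>" "q s \<noteq> \<zero>" "q w \<noteq> \<zero>"
    using internal_nonisotropic p u pD(3) ts w by auto
  have c: "q p \<in> carrier F" "q u \<in> carrier F" "q s \<in> carrier F" "q w \<in> carrier F"
    using pD(1) uD(1) V w by simp_all
  have tq: "\<ominus> (t \<otimes> q p) \<in> carrier F" using ts(1) c by simp
  \<comment> \<open>The vector of the plane of \<open>p\<close> and \<open>s\<close> orthogonal to
    \<open>u\<close>, scaled to avoid division.\<close>
  let ?s = "q s \<cdot> p \<boxplus> (\<ominus> (t \<otimes> q p)) \<cdot> s"
  have sV: "?s \<in> V" using pD(1) V c tq by simp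
  have qu: "q u = t \<otimes> t \<otimes> q p \<oplus> q s"
    using q_orthogonal[OF ts(1) one_closed pD(1) V(1,2)] c V unfolding eq by simp
  have qs: "q ?s = q s \<otimes> (q p \<otimes> q u)"
  proof -
    have "q ?s = q s \<otimes> q s \<otimes> q p \<oplus> (\<ominus> (t \<otimes> q p)) \<otimes> (\<ominus> (t \<otimes> q p)) \<otimes> q s"
      using q_orthogonal[OF c(3) tq pD(1) V(1,2)] .
    also have "\<dots> = q s \<otimes> (q p \<otimes> (t \<otimes> t \<otimes> q p \<oplus> q s))"
      using c(1,3) ts(1) by algebra
    finally show ?thesis unfolding qu .
  qed
  have us: "B u ?s = \<zero>"
  proof -
    have "B u ?s = t \<otimes> (q s \<otimes> B p p) \<oplus> (\<ominus> (t \<otimes> q p)) \<otimes> B s s"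
      using ts(1) V pD(1) c tq unfolding eq by (simp add: m_lcomm)
    also have "\<dots> = \<zero>"
      unfolding B_self[OF V(1)] B_self[OF pD(1)] using ts(1) c(1,3) by algebra
    finally show ?thesis .
  qed
  have uw: "B u w = \<zero>" using ts(1) w V pD(1) unfolding eq by simp
  have ws: "B w ?s = \<zero>" using wp w(1) V(1) pD(1) c tq by simp
  have qs0: "q ?s \<noteq> \<zero>" unfolding qs using c nz by (simp add: integral_iff)
  have "\<not> is_square (q w \<otimes> q s)"
    using internal_iff[of p w s] p pD V w wp nz by simp
  moreover have "\<not> is_square (q w \<otimes> q ?s)"
    using internal_iff[OF uD(1,2) w(1) sV uw us ws nz(4) qs0] u by simp
  ultimately have "is_square ((q w \<otimes> q s) \<otimes> (q w \<otimes> q ?s))"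
    using c q_closed[OF sV] by (intro is_square_mult_nonsquares) simp_all
  also have "(q w \<otimes> q s) \<otimes> (q w \<otimes> q ?s) = ((q w \<otimes> q s) \<otimes> (q w \<otimes> q s)) \<otimes> (q p \<otimes> q u)"
    unfolding qs using c by (simp add: m_ac)
  finally have "is_square (((q w \<otimes> q s) \<otimes> (q w \<otimes> q s)) \<otimes> (q p \<otimes> q u))" .
  then show ?thesis
    using is_square_cancel[of "(q w \<otimes> q s) \<otimes> (q w \<otimes> q s)" "q p \<otimes> q u"] c nz
    by (auto simp: is_square_def integral_iff)
qed

text \<open>Write an internal \<open>u\<close> as \<open>t \<cdot> p \<boxplus> s\<close> for a
  fixed internal \<open>p\<close>. For \<open>s = o\<^sub>v\<close> there are only the nonzero
  multiples of \<open>p\<close>. Otherwise t^2 + q(s)/q(p) is a nonzero square, because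
  \<open>q p \<otimes> q u\<close> is one, and the hyperbola count bounds the choices of
  \<open>t\<close> for each \<open>s\<close>.\<close>

lemma card_internal_le:
  "2 * card {u. internal u} \<le> (card (carrier F) ^ 2 + 1) * (card (carrier F) - 1)"
proof -
  obtain p where p: "internal p" using internal_exists by blast
  note pD = internalD[OF p]
  have qp: "q p \<in> carrier F" "q p \<noteq> \<zero>" using pD(1) internal_nonisotropic[OF p] by simp_all
  then have ip: "inv (q p) \<in> carrier F" "inv (q p) \<otimes> q p = \<one>"
    using field_Units by simp_all
  then have ip0: "inv (q p) \<noteq> \<zero>" using qp by force
  let ?N = "card (carrier F)" and ?C = "carrier F - {\<zero>}"
  define T where "T s = {t \<in> carrier F. \<exists>y\<in>carrier F. y \<noteq> \<zero> \<and> t \<otimes> t \<oplus> inv (q p) \<otimes> q s = y \<otimes> y}" for s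
  have Tle: "2 * card (T s) \<le> ?N - 1" if s: "s \<in> perp p - {o\<^sub>v}" for s
  proof -
    have "q s \<in> carrier F" "q s \<noteq> \<zero>" using s pD(3) by auto
    then show ?thesis
      unfolding T_def using ip ip0 by (intro card_nonzero_square_translates) (simp_all add: integral_iff)
  qed
  let ?A = "(\<lambda>t. t \<cdot> p) ` ?C" and ?P = "SIGMA s : perp p - {o\<^sub>v}. T s"
  let ?D = "(\<lambda>(s, t). t \<cdot> p \<boxplus> s) ` ?P"
  have "{u. internal u} \<subseteq> ?A \<union> ?D"
  proof
    fix u assume "u \<in> {u. internal u}"
    then have u: "internal u" by simp
    obtain t s where ts: "t \<in> carrier F" "s \<in> perp p" "u = t \<cdot> p \<boxplus> s"
      using perp_decomp[OF pD(1) qp(2) internalD(1)[OF u]] .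
    show "u \<in> ?A \<union> ?D"
    proof (cases "s = o\<^sub>v")
      case True
      then have "u = t \<cdot> p" using ts pD(1) by simp
      moreover have "t \<noteq> \<zero>" using calculation internalD(2)[OF u] pD(1) by auto
      ultimately show ?thesis using ts(1) by blast
    next
      case False
      have sV: "s \<in> V" "B p s = \<zero>" "q s \<in> carrier F" using ts by simp_all
      let ?x = "t \<otimes> t \<oplus> inv (q p) \<otimes> q s"
      have x: "?x \<in> carrier F" using ts(1) ip sV by simp
      have qu: "q u = t \<otimes> t \<otimes> q p \<oplus> q s"
        using q_orthogonal[OF ts(1) one_closed pD(1) sV(1,2)] sV unfolding ts(3) by simp
      have e: "q p \<otimes> ?x = q u"
      proof -
        have "q p \<otimes> ?x = t \<otimes> t \<otimes> q p \<oplus> (inv (q p) \<otimes> q p) \<otimes> q s"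
          using qp(1) ip(1) sV(3) ts(1) by algebra
        then show ?thesis unfolding ip(2) qu using sV by simp
      qed
      have "is_square (q p \<otimes> (q p \<otimes> ?x))"
        unfolding e using internal_product_square[OF p u ts(1,2) False ts(3)] .
      then have "is_square ((q p \<otimes> q p) \<otimes> ?x)" using qp x by (simp add: m_assoc)
      then have "is_square ?x"
        using is_square_cancel[of "q p \<otimes> q p" ?x] qp x by (auto simp: is_square_def integral_iff)
      then obtain y where y: "y \<in> carrier F" "?x = y \<otimes> y" by (auto simp: is_square_def)
      have "y \<noteq> \<zero>"
        using y e internal_nonisotropic[OF u] qp(1) by auto
      then have "t \<in> T s" using y ts(1) by (auto simp: T_def)
      then have "(s, t) \<in> ?P" using ts(2) False by simp
      then show ?thesis using ts(3) by force
    qed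
  qed
  moreover have fin: "finite ?A" "finite ?P"
    using finite_carrier by (simp, intro finite_SigmaI) (simp_all add: T_def)
  ultimately have "card {u. internal u} \<le> card (?A \<union> ?D)"
    by (intro card_mono) simp_all
  also have "\<dots> \<le> card ?A + card ?D" by (rule card_Un_le)
  also have "\<dots> \<le> card ?C + card ?P"
    using fin finite_carrier by (intro add_mono card_image_le) simp_all
  finally have "2 * card {u. internal u} \<le> 2 * card ?C + 2 * card ?P" by simp
  also have "2 * card ?P = (\<Sum>s\<in>perp p - {o\<^sub>v}. 2 * card (T s))"
    using finite_carrier by (subst card_SigmaI) (simp_all add: T_def sum_distrib_left)
  also have "\<dots> \<le> (\<Sum>s\<in>perp p - {o\<^sub>v}. ?N - 1)" by (rule sum_mono) (rule Tle)
  also have "\<dots> = (?N ^ 2 - 1) * (?N - 1)" using pD by (simp add: card_perp)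
  also have "2 * card ?C = 2 * (?N - 1)" using finite_carrier by simp
  also have "2 * (?N - 1) + (?N ^ 2 - 1) * (?N - 1) = (?N ^ 2 + 1) * (?N - 1)"
  proof -
    have "?N ^ 2 \<ge> 1" using card_carrier_gt by simp
    then have "2 + (?N ^ 2 - 1) = ?N ^ 2 + 1" by simp
    then show ?thesis by (metis add_mult_distrib)
  qed
  finally show ?thesis by simp
qed

text \<open>A triangle would be three pairwise orthogonal internal vectors, against the dichotomy. A
  common neighbour of two lines contains both of their poles, so it is the line joining
  them.\<close>

lemma polarity_graph_parameters:
  defines "E \<equiv> external_lines F Q" and "adj \<equiv> polar_conjugate F Q" and "N \<equiv> card (carrier F)"
  obtains k where "edge_regular E adj (card E) k 0" "2 * k = N + 1" "2 * card E \<le> N ^ 2 + 1" "E \<noteq> {}"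
    and "C4_free E adj"
proof -
  have N: "N > 1" using card_carrier_gt by (simp add: N_def)
  have fin: "finite E"
    unfolding E_def external_lines_eq
    by (rule finite_imageI, rule finite_subset[OF _ finite_triples]) (use internalD(1) in blast)
  have adj: "adj (perp p) (perp r) \<longleftrightarrow> B p r = \<zero>" if "internal p" "internal r" for p r
    unfolding adj_def by (rule polar_conjugate_perp[OF that])
  have sym: "B p r = \<zero> \<longleftrightarrow> B r p = \<zero>" if "internal p" "internal r" for p r
    using B_sym internalD(1) that by auto
  have E: "\<exists>p. internal p \<and> a = perp p" if "a \<in> E" for a
    using that unfolding E_def external_lines_eq by blast
  have degree: "2 * card {b \<in> E. adj a b} = N + 1" if a: "a \<in> E" for a
  proof -
    obtain p where p: "internal p" "a = perp p" using E[OF a] by blast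
    let ?S = "{r. internal r \<and> B p r = \<zero>}"
    have eq: "{b \<in> E. adj a b} = perp ` ?S"
      unfolding E_def external_lines_eq using adj[OF p(1)] p(2) by blast
    have "card ?S = (N - 1) * card (perp ` ?S)"
      unfolding N_def using internalD(1)[OF p(1)] internalD(1)
      by (intro card_internal_cone) (auto intro: internal_tscale)
    then have "(N - 1) * (2 * card (perp ` ?S)) = N ^ 2 - 1"
      using card_internal_perp[OF p(1)] by (simp add: N_def)
    also have "\<dots> = (N - 1) * (N + 1)" using N by (simp add: power2_eq_square algebra_simps)
    finally have "(N - 1) * (2 * card (perp ` ?S)) = (N - 1) * (N + 1)" .
    moreover have "N - 1 \<noteq> 0" using N by simp
    ultimately show ?thesis unfolding eq using mult_left_cancel[of "N - 1"] by blast
  qed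
  obtain p where p: "internal p" using internal_exists by blast
  then have pE: "perp p \<in> E" unfolding E_def external_lines_eq by blast
  define k where "k = card {b \<in> E. adj (perp p) b}"
  have k: "2 * k = N + 1" unfolding k_def using degree[OF pE] .
  have irrefl: "\<not> adj a a" for a by (simp add: adj_def polar_conjugate_def)
  have symm: "adj b a" if "a \<in> E" "b \<in> E" "adj a b" for a b
    using that E[of a] E[of b] adj sym by metis
  have deg: "card {b \<in> E. adj a b} = k" if "a \<in> E" for a
    using degree[OF that] k by simp
  have tri: "{c \<in> E. adj a c \<and> adj b c} = {}" if ab: "a \<in> E" "b \<in> E" "adj a b" for a b
  proof (rule ccontr)
    assume "{c \<in> E. adj a c \<and> adj b c} \<noteq> {}"
    then obtain c where c: "c \<in> E" "adj a c" "adj b c" by blast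
    obtain x y z where xyz: "internal x" "internal y" "internal z" "a = perp x" "b = perp y" "c = perp z"
      using E[OF ab(1)] E[OF ab(2)] E[OF c(1)] by metis
    have "B x y = \<zero>" "B x z = \<zero>" "B y z = \<zero>"
      using adj xyz ab c by auto
    then show False
      using internal_dichotomy[of x y z] xyz internalD(1,2) by simp
  qed
  have "edge_regular E adj (card E) k 0"
    unfolding edge_regular_def
  proof (intro conjI ballI impI)
    show "card {c \<in> E. adj a c \<and> adj b c} = 0" if "a \<in> E" "b \<in> E" "adj a b" for a b
      unfolding tri[OF that] by simp
  qed (use fin irrefl symm deg in blast)+
  moreover have "2 * card E \<le> N ^ 2 + 1"
  proof -
    have "card {u. internal u} = (N - 1) * card (perp ` {u. internal u})"
      unfolding N_def by (intro card_internal_cone) (auto intro: internal_tscale)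
    then have "(N - 1) * (2 * card E) \<le> (N - 1) * (N ^ 2 + 1)"
      using card_internal_le unfolding E_def external_lines_eq N_def by (simp add: mult.commute)
    moreover have "0 < N - 1" using N by simp
    ultimately show ?thesis using nat_mult_le_cancel1 by blast
  qed
  moreover have "E \<noteq> {}" using pE by blast
  moreover have "C4_free E adj"
  proof -
    have "c = d"
      if h: "a \<in> E" "b \<in> E" "c \<in> E" "d \<in> E" "a \<noteq> b" "adj a c" "adj b c" "adj a d" "adj b d" for a b c d
    proof -
      obtain x y where xy: "internal x" "internal y" "a = perp x" "b = perp y"
        using E[OF h(1)] E[OF h(2)] by metis
      obtain r s where rs: "internal r" "internal s" "c = perp r" "d = perp s"
        using E[OF h(3)] E[OF h(4)] by metis
      note V = internalD(1,2)[OF xy(1)] internalD(1,2)[OF xy(2)] internalD(1,2)[OF rs(1)] internalD(1,2)[OF rs(2)]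
      have orth: "B x r = \<zero>" "B y r = \<zero>" "B x s = \<zero>" "B y s = \<zero>"
        using h adj xy rs by auto
      have ind: "independent_pair F x y"
        unfolding independent_pair_def
      proof (intro ballI impI)
        fix m n assume mn: "m \<in> carrier F" "n \<in> carrier F" "m \<cdot> x \<boxplus> n \<cdot> y = o\<^sub>v"
        \<comment> \<open>Proportional poles would give the same line, against
          \<open>a \<noteq> b\<close>.\<close>
        have "n = \<zero>"
        proof (rule ccontr)
          assume n: "n \<noteq> \<zero>"
          then have inv: "inv n \<in> carrier F" "inv n \<otimes> n = \<one>" using mn field_Units by simp_all
          have "n \<cdot> y = (\<ominus> m) \<cdot> x"
            using tadd_diff(3)[of m x "n \<cdot> y"] mn V by simp
          then have "inv n \<cdot> n \<cdot> y = inv n \<cdot> (\<ominus> m) \<cdot> x" by simp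
          then have y: "y = (inv n \<otimes> \<ominus> m) \<cdot> x" using inv mn V by simp
          moreover have "inv n \<otimes> \<ominus> m \<in> carrier F - {\<zero>}"
            using inv mn V y by (cases "inv n \<otimes> \<ominus> m = \<zero>") auto
          ultimately have "perp y = perp x" using perp_eq_iff[OF xy(1,2)] by blast
          then show False using h xy by simp
        qed
        then show "m = \<zero> \<and> n = \<zero>" using mn V tscale_eq_tzero[of m x] by simp
      qed
      have "span2 x y = perp r" "span2 x y = perp s"
        using V orth B_sym[of r] B_sym[of s] by (intro span2_eq_perp[OF _ _ _ _ ind]; simp)+
      then show ?thesis using rs by simp
    qed
    then show ?thesis unfolding C4_free_def by blast
  qed
  ultimately show ?thesis using that k by blast
qed

end

section \<open>The choice of the prime\<close>

text \<open>Euclid's argument: a prime factor of the squared factorial plus one exceeds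
  \<open>m + 2\<close>. The shift by 2 also makes the prime odd.\<close>

lemma infinite_primes_dvd_square_plus_one:
  "infinite {p :: nat. prime p \<and> odd p \<and> (\<exists>n. p dvd n\<^sup>2 + 1)}"
  unfolding infinite_nat_iff_unbounded
proof
  fix m :: nat
  obtain p :: nat where p: "prime p" "p dvd (fact (m + 2))\<^sup>2 + 1"
    using prime_factor_nat[of "(fact (m + 2))\<^sup>2 + 1"] by auto
  have "\<not> p \<le> m + 2"
  proof
    assume "p \<le> m + 2"
    then have "p dvd fact (m + 2)" using prime_dvd_fact_iff[OF p(1)] by blast
    then have "p dvd (fact (m + 2))\<^sup>2" using prime_dvd_power_iff[OF p(1)] by simp
    then have "p dvd 1" using p(2) dvd_add_right_iff by blast
    then show False using p(1) by simp
  qed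
  then have "p > m" "odd p" using prime_odd_nat[OF p(1)] by simp_all
  then show "\<exists>p>m. p \<in> {p. prime p \<and> odd p \<and> (\<exists>n. p dvd n\<^sup>2 + 1)}" using p by blast
qed

lemma (in ring) add_pow_card_carrier:
  assumes "a \<in> carrier R"
  shows "[card (carrier R)] \<cdot> a = \<zero>"
  using group.pow_order_eq_1[OF a_group, of a] assms by (simp add: add_pow_def order_def)

text \<open>The order of the field annihilates the unit, and it divides n^2 + 1, so the multiple
  \<open>n\<close> of the unit squares to -1.\<close>

lemma conic_planeI:
  assumes F: "field F" and odd: "odd (card (carrier F))" and n: "card (carrier F) dvd n\<^sup>2 + 1"
    and Q: "nondegenerate_conic F Q"
  shows "conic_plane F Q"
proof -
  interpret field F by (rule F)
  have multiple: "[m] \<cdot>\<^bsub>F\<^esub> \<one>\<^bsub>F\<^esub> = \<zero>\<^bsub>F\<^esub>" if "card (carrier F) dvd m" for m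
  proof -
    from that obtain k where "m = card (carrier F) * k" ..
    then have "[m] \<cdot>\<^bsub>F\<^esub> \<one>\<^bsub>F\<^esub> = [k] \<cdot>\<^bsub>F\<^esub> ([card (carrier F)] \<cdot>\<^bsub>F\<^esub> \<one>\<^bsub>F\<^esub>)"
      by (simp add: add.nat_pow_pow)
    then show ?thesis by (simp add: add_pow_card_carrier)
  qed
  show ?thesis
  proof unfold_locales
    \<comment> \<open>An infinite carrier has \<open>card\<close> equal to 0, which is even.\<close>
    show "finite (carrier F)" using odd by (metis card.infinite even_zero)
    show "\<one>\<^bsub>F\<^esub> \<oplus>\<^bsub>F\<^esub> \<one>\<^bsub>F\<^esub> \<noteq> \<zero>\<^bsub>F\<^esub>"
    proof
      assume two: "\<one>\<^bsub>F\<^esub> \<oplus>\<^bsub>F\<^esub> \<one>\<^bsub>F\<^esub> = \<zero>\<^bsub>F\<^esub>"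
      \<comment> \<open>In characteristic two an odd multiple of the unit would be the unit, whereas
        this one is zero.\<close>
      obtain m where m: "card (carrier F) = Suc (m * 2)" using odd by (auto elim!: oddE)
      have "[(2 :: nat)] \<cdot>\<^bsub>F\<^esub> \<one>\<^bsub>F\<^esub> = \<zero>\<^bsub>F\<^esub>" using two by (simp add: numeral_2_eq_2)
      then have "[(m * 2)] \<cdot>\<^bsub>F\<^esub> \<one>\<^bsub>F\<^esub> = \<zero>\<^bsub>F\<^esub>"
        using add.nat_pow_pow[of "\<one>\<^bsub>F\<^esub>" m 2] by (simp add: mult.commute)
      then have "[card (carrier F)] \<cdot>\<^bsub>F\<^esub> \<one>\<^bsub>F\<^esub> = \<one>\<^bsub>F\<^esub>" by (simp add: m)
      then show False using multiple[of "card (carrier F)"] by simp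
    qed
    let ?i = "[n] \<cdot>\<^bsub>F\<^esub> \<one>\<^bsub>F\<^esub>"
    have "?i \<otimes>\<^bsub>F\<^esub> ?i \<oplus>\<^bsub>F\<^esub> \<one>\<^bsub>F\<^esub> = [(n\<^sup>2 + 1)] \<cdot>\<^bsub>F\<^esub> \<one>\<^bsub>F\<^esub>"
      by (simp add: add_pow_ldistr add.nat_pow_pow power2_eq_square)
    also have "\<dots> = \<zero>\<^bsub>F\<^esub>" by (rule multiple[OF n])
    finally have "?i \<otimes>\<^bsub>F\<^esub> ?i = \<ominus>\<^bsub>F\<^esub> \<one>\<^bsub>F\<^esub>" using minus_equality[of "?i \<otimes>\<^bsub>F\<^esub> ?i"] by simp
    then show "\<exists>i\<in>carrier F. i \<otimes>\<^bsub>F\<^esub> i = \<ominus>\<^bsub>F\<^esub> \<one>\<^bsub>F\<^esub>" using add.nat_pow_closed[OF one_closed] by blast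
  qed (rule Q)
qed

text \<open>Integers modulo \<open>p\<close>, transported along a bijection onto a
  \<open>p\<close>-element subset of the type. This keeps the quantification over all fields of
  order \<open>p\<close> on that type from being vacuous.\<close>

lemma prime_field_on_infinite_type:
  assumes "infinite (UNIV :: 'a set)" and p: "prime p"
  shows "\<exists>F :: 'a ring. field F \<and> card (carrier F) = p"
proof -
  let ?R = "residue_ring (int p)"
  interpret R: residues_prime p ?R by (rule residues_prime.intro[OF p])
  have carrier: "carrier ?R = {0..int p - 1}" by (simp add: residue_ring_def)
  obtain A :: "'a set" where A: "finite A" "card A = p"
    using infinite_arbitrarily_large[OF assms(1)] by blast
  then obtain f where f: "bij_betw f (carrier ?R) A"
    using finite_same_card_bij[of "carrier ?R" A] by (auto simp: carrier)
  then have "field (image_ring f ?R)"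
    using field.inj_imp_image_ring_is_field[OF R.is_field] unfolding bij_betw_def by blast
  moreover have "card (carrier (image_ring f ?R)) = p"
    using f A by (simp add: image_ring_carrier bij_betw_def)
  ultimately show ?thesis by blast
qed

theorem theorem5p5:
  assumes "infinite (UNIV :: 'a set)"
  shows "infinite {q :: nat. odd q \<and> primepow q \<and>
    (\<exists>F :: 'a ring. field F \<and> card (carrier F) = q) \<and>
    (\<forall>(F :: 'a ring) Q.
       field F \<and> card (carrier F) = q \<and> nondegenerate_conic F Q \<longrightarrow>
       (\<exists>v k l.
          edge_regular (external_lines F Q) (polar_conjugate F Q) v k l \<and>
          real (CAP_bound v k l)
            < Delsarte_bound (external_lines F Q) (polar_conjugate F Q) k))}"
    (is "infinite ?S")
proof (rule infinite_super[OF _ infinite_primes_dvd_square_plus_one], rule subsetI)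
  fix p assume "p \<in> {p :: nat. prime p \<and> odd p \<and> (\<exists>n. p dvd n\<^sup>2 + 1)}"
  then obtain n where p: "prime p" "odd p" "p dvd n\<^sup>2 + 1" by blast
  have "\<exists>v k l. edge_regular (external_lines F Q) (polar_conjugate F Q) v k l \<and>
      real (CAP_bound v k l) < Delsarte_bound (external_lines F Q) (polar_conjugate F Q) k"
    if F: "field F" "card (carrier F) = p" "nondegenerate_conic F Q" for F :: "'a ring" and Q
  proof -
    interpret conic_plane F Q
      using conic_planeI[of F n Q] F p by simp
    let ?E = "external_lines F Q" and ?adj = "polar_conjugate F Q"
    obtain k where k: "edge_regular ?E ?adj (card ?E) k 0" "2 * k = card (carrier F) + 1"
        "2 * card ?E \<le> (card (carrier F))\<^sup>2 + 1" "?E \<noteq> {}" "C4_free ?E ?adj"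
      using polarity_graph_parameters .
    obtain m where m: "k = Suc m" using k(2) by (cases k) auto
    have "card (carrier F) = 2 * m + 1" using k(2) m by simp
    \<comment> \<open>With k = m + 1 the left side is at most 2 m^2 + 2 m + 1 and the right side is
      2 m^2 + 2 m + 2.\<close>
    then have "card ?E < 2 * (k * (k - 1) + 1)"
      using k(3) m by (simp add: power2_eq_square algebra_simps)
    then show ?thesis
      using CAP_bound_less_Delsarte_bound[OF k(1,4) _ k(5)] k(1) m by blast
  qed
  moreover have "primepow p" using p(1) by (rule primepow_prime)
  ultimately show "p \<in> ?S"
    using p(2) prime_field_on_infinite_type[OF assms p(1)] by blast
qed

end
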